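(* Let $J \subset \mathbf{E}^2$ be a Jordan domain and let $X \subseteq J$ be its set of finite-distance points, equipped with the length metric $d$. Then $(X,d)$ is a CAT(0) space.
   Context: A Jordan domain $J$ is a subset of the Euclidean plane $\mathbf{E}^2$ that is the homeomorphic image of a closed disk; its boundary $\partial J$ is the image of the boundary circle (a Jordan curve), and its interior is the bounded component of the complement of that curve. The set $X$ of finite-distance points of $J$ consists of all interior points of $J$ together with those points of $\partial J$ that can be connected to some (equivalently, every) interior point by a curve in $J$ of finite Euclidean length. The length metric on $X$ is $d(x,y) = $ the infimum of the Euclidean lengths of curves in $J$ joining $x$ to $y$. A geodesic triangle in a metric space consists of three shortest curves (its sides) connecting a triple of points (its vertices). A comparison triangle is a triangle in $\mathbf{E}^2$ with the same side-lengths; taking equal distances from the vertices gives comparison points on its sides for points on the sides of the original triangle. A geodesic triangle is thin if the distance between every pair of points on its sides is $\le$ the Euclidean distance between the comparison points. A CAT(0) space is a complete metric space such that every pair of points can be joined by a (finite-length) geodesic (a shortest curve, whose length equals the distance between its ends) and every geodesic triangle is thin. *)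

theory Defs
  imports "HOL-Analysis.Analysis"
begin

text \<open>
  The Euclidean plane is represented by \<^typ>\<open>complex\<close> with its metric \<^term>\<open>dist\<close>, as in the
  library's Jordan curve theorem. Curves are parametrised by the unit interval.
\<close>

text \<open>
  The length of a curve with respect to a distance function \<open>d\<close>, possibly infinite, is the supremum
  over all subdivisions of the unit interval, given as sorted lists of parameters. (Omitting the
  end points from a subdivision does not affect the supremum.)
\<close>

definition curve_length :: "('a \<Rightarrow> 'a \<Rightarrow> real) \<Rightarrow> (real \<Rightarrow> 'a) \<Rightarrow> ennreal" where
  "curve_length d g =
     (SUP ts \<in> {ts. sorted ts \<and> set ts \<subseteq> {0..1}}.
        \<Sum>i<length ts - 1. ennreal (d (g (ts ! i)) (g (ts ! Suc i))))"

definition curves_in :: "complex set \<Rightarrow> complex \<Rightarrow> complex \<Rightarrow> (real \<Rightarrow> complex) set" where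
  "curves_in J x y =
     {g. path g \<and> path_image g \<subseteq> J \<and> pathstart g = x \<and> pathfinish g = y}"


text \<open>
  \<open>jordan_domain J C\<close>: the set \<open>J\<close> is a Jordan domain with boundary curve \<open>C\<close>. Its interior is
  \<^term>\<open>inside C\<close>, the library's union of the bounded components of the complement of \<open>C\<close>; for a
  Jordan curve there is exactly one such component.
\<close>

definition jordan_domain :: "complex set \<Rightarrow> complex set \<Rightarrow> bool" where
  "jordan_domain J C \<longleftrightarrow>
     (\<exists>h k. homeomorphism (cball (0::complex) 1) J h k \<and> C = h ` sphere 0 1)"

definition finite_distance_points :: "complex set \<Rightarrow> complex set \<Rightarrow> complex set" where
  "finite_distance_points J C =
     inside C \<union> {p \<in> C. \<exists>q \<in> inside C. \<exists>g \<in> curves_in J p q. curve_length dist g < \<infinity>}"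

text \<open>
  The conversion \<^const>\<open>enn2real\<close> sends \<open>\<infinity>\<close> to \<open>0\<close>. Hence the requirement below that the length
  metric be positive at distinct points of \<open>X\<close> includes the finiteness of the infimum there.
\<close>

definition length_metric :: "complex set \<Rightarrow> complex \<Rightarrow> complex \<Rightarrow> real" where
  "length_metric J x y = enn2real (INF g \<in> curves_in J x y. curve_length dist g)"


definition geodesic :: "'a set \<Rightarrow> ('a \<Rightarrow> 'a \<Rightarrow> real) \<Rightarrow> (real \<Rightarrow> 'a) \<Rightarrow> 'a \<Rightarrow> 'a \<Rightarrow> bool" where
  "geodesic X d g x y \<longleftrightarrow>
     continuous_map (top_of_set {0..1}) (Metric_space.mtopology X d) g \<and>
     g 0 = x \<and> g 1 = y \<and> curve_length d g = ennreal (d x y)"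

definition geodesic_triangle ::
  "'a set \<Rightarrow> ('a \<Rightarrow> 'a \<Rightarrow> real) \<Rightarrow> 'a \<Rightarrow> 'a \<Rightarrow> 'a \<Rightarrow>
   (real \<Rightarrow> 'a) \<Rightarrow> (real \<Rightarrow> 'a) \<Rightarrow> (real \<Rightarrow> 'a) \<Rightarrow> bool" where
  "geodesic_triangle X d a b c \<alpha> \<beta> \<gamma> \<longleftrightarrow>
     geodesic X d \<alpha> a b \<and> geodesic X d \<beta> b c \<and> geodesic X d \<gamma> c a"

definition comparison_triangle ::
  "('a \<Rightarrow> 'a \<Rightarrow> real) \<Rightarrow> 'a \<Rightarrow> 'a \<Rightarrow> 'a \<Rightarrow> complex \<Rightarrow> complex \<Rightarrow> complex \<Rightarrow> bool" where
  "comparison_triangle d a b c a' b' c' \<longleftrightarrow>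
     dist a' b' = d a b \<and> dist b' c' = d b c \<and> dist c' a' = d c a"

text \<open>
  The point \<open>p\<close> lies on the side \<open>g\<close> joining \<open>x\<close> to \<open>y\<close>, and \<open>p'\<close> is its comparison point on the
  corresponding side of the comparison triangle.
\<close>

definition comparison_on_side ::
  "('a \<Rightarrow> 'a \<Rightarrow> real) \<Rightarrow> (real \<Rightarrow> 'a) \<Rightarrow> 'a \<Rightarrow> 'a \<Rightarrow> complex \<Rightarrow> complex \<Rightarrow> 'a \<Rightarrow> complex \<Rightarrow> bool" where
  "comparison_on_side d g x y x' y' p p' \<longleftrightarrow>
     p \<in> g ` {0..1} \<and> p' \<in> closed_segment x' y' \<and> dist x' p' = d x p \<and> dist y' p' = d y p"

text \<open>
  Both points of a pair range over all three sides, and a point lying on several sides is taken with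
  each of its comparison points. All comparison triangles of a given triangle are congruent and, by
  the triangle inequality, one exists; so it is immaterial that they are quantified universally.
\<close>

definition thin_triangle ::
  "('a \<Rightarrow> 'a \<Rightarrow> real) \<Rightarrow> 'a \<Rightarrow> 'a \<Rightarrow> 'a \<Rightarrow>
   (real \<Rightarrow> 'a) \<Rightarrow> (real \<Rightarrow> 'a) \<Rightarrow> (real \<Rightarrow> 'a) \<Rightarrow> bool" where
  "thin_triangle d a b c \<alpha> \<beta> \<gamma> \<longleftrightarrow>
     (\<forall>a' b' c'. comparison_triangle d a b c a' b' c' \<longrightarrow>
        (let compares = (\<lambda>p p'. comparison_on_side d \<alpha> a b a' b' p p' \<or>
                                comparison_on_side d \<beta> b c b' c' p p' \<or>
                                comparison_on_side d \<gamma> c a c' a' p p')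
         in \<forall>p p' q q'. compares p p' \<longrightarrow> compares q q' \<longrightarrow> d p q \<le> dist p' q'))"

definition CAT0_space :: "'a set \<Rightarrow> ('a \<Rightarrow> 'a \<Rightarrow> real) \<Rightarrow> bool" where
  "CAT0_space X d \<longleftrightarrow>
     Metric_space X d \<and> Metric_space.mcomplete X d \<and>
     (\<forall>x\<in>X. \<forall>y\<in>X. \<exists>g. geodesic X d g x y) \<and>
     (\<forall>a b c \<alpha> \<beta> \<gamma>. geodesic_triangle X d a b c \<alpha> \<beta> \<gamma> \<longrightarrow> thin_triangle d a b c \<alpha> \<beta> \<gamma>)"

end

theory Submission
  imports Defs "HOL-Complex_Analysis.Great_Picard"
begin

text \<open>
  The CAT(0) condition can be expressed by one inequality between distances: Stewart's formula for
  the length of the segment from a vertex of a triangle to a point of the opposite side, with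
  \<open>\<le>\<close> in place of equality (\<open>stewart_ineq\<close>). Thinness of all geodesic triangles follows from it by
  using it twice (\<open>geodesic_triangle_thin\<close>), and the inequality has two properties that carry the
  proof.

  It survives gluing. If two spaces that satisfy it are glued along a common convex subset, then
  so does the union (Reshetnyak's theorem, \<open>glued_stewart\<close>). Angles do not occur in the proof. The
  only analytic step is that a geodesic from one side to the other cannot be shortened, to first
  order, by moving its crossing point inside the common subset; the rest is algebra
  (\<open>joint_stewart\<close>). A compact connected union of finitely many grid squares with connected
  complement is obtained by such gluings: if a maximal run of squares is removed from its top row,
  then, by Janiszewski's theorem, each component of what remains meets the run in a horizontal
  segment (\<open>hadamard_region_grid_cells\<close>).

  It survives limits. A Jordan domain \<open>J\<close> has a connected complement, hence it is the limit of
  unions \<open>P\<^sub>k\<close> of grid squares as above that are neighbourhoods of \<open>J\<close>. Since \<open>P\<^sub>k\<close> contains \<open>J\<close>, its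
  distances are at most those in \<open>J\<close>. Conversely, by the theorem of Arzela and Ascoli,
  curves in \<open>P\<^sub>k\<close> of bounded length subconverge to a curve in \<open>J\<close> that is not longer than their
  limiting length (\<open>reach_limit\<close>). Hence the distances in \<open>P\<^sub>k\<close> converge to those
  in \<open>J\<close> (\<open>lipdist_tendsto\<close>), although shortest curves of \<open>J\<close> may run along its boundary, and
  Stewart's inequality passes to \<open>J\<close> (\<open>ratio_point_limit\<close>). The same compactness argument gives
  geodesics and completeness (\<open>CAT0_space_lipdist\<close>). The finite-distance points are exactly the
  points of \<open>J\<close> that are joined to the interior by a rectifiable curve, so they form one class of
  mutually reachable points.
\<close>

section \<open>Stewart's inequality and gluing\<close>

definition lies_between :: "('a \<Rightarrow> 'a \<Rightarrow> real) \<Rightarrow> 'a \<Rightarrow> 'a \<Rightarrow> 'a \<Rightarrow> bool" where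
  "lies_between d x n y \<longleftrightarrow> d x y = d x n + d n y"

text \<open>
  For a point \<open>n\<close> between \<open>x\<close> and \<open>y\<close> this compares \<open>d p n\<close> with the same distance in a Euclidean triangle
  with the sides \<open>d p x\<close>, \<open>d p y\<close>, \<open>d x y\<close>; the formula is Stewart's, with denominators cleared. At the
  midpoint it is the CN inequality of Bruhat and Tits.
\<close>

definition stewart_ineq :: "('a \<Rightarrow> 'a \<Rightarrow> real) \<Rightarrow> 'a \<Rightarrow> 'a \<Rightarrow> 'a \<Rightarrow> 'a \<Rightarrow> bool" where
  "stewart_ineq d p x n y \<longleftrightarrow>
     (d p n)\<^sup>2 * (d x n + d n y) \<le>
       (d p x)\<^sup>2 * d n y + (d p y)\<^sup>2 * d x n - d x n * d n y * (d x n + d n y)"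

definition stewart_on :: "'a set \<Rightarrow> ('a \<Rightarrow> 'a \<Rightarrow> real) \<Rightarrow> bool" where
  "stewart_on X d \<longleftrightarrow>
     (\<forall>p\<in>X. \<forall>x\<in>X. \<forall>n\<in>X. \<forall>y\<in>X. lies_between d x n y \<longrightarrow> stewart_ineq d p x n y)"

text \<open>
  Existence of geodesics, expressed by single points: this form needs no choice of curves when
  spaces are glued.
\<close>

definition divisible_on :: "'a set \<Rightarrow> ('a \<Rightarrow> 'a \<Rightarrow> real) \<Rightarrow> bool" where
  "divisible_on X d \<longleftrightarrow>
     (\<forall>x\<in>X. \<forall>y\<in>X. \<forall>t\<in>{0..1}. \<exists>m\<in>X. d x m = t * d x y \<and> d m y = (1 - t) * d x y)"

text \<open>
  The functions \<open>sqrt (a\<^sup>2 + t * X)\<close> and \<open>sqrt (b\<^sup>2 + t * Y)\<close> have the derivatives \<open>X / (2 * a)\<close> and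
  \<open>Y / (2 * b)\<close> at \<open>0\<close>. If their sum is at least its initial value for arbitrarily small \<open>t\<close>, up to an
  error of second order, then the sum of the derivatives is nonnegative.
\<close>

lemma first_variation_nonneg:
  fixes a b X Y K :: real
  assumes "a > 0" "b > 0"
    and approx: "\<And>\<epsilon>. \<epsilon> > 0 \<Longrightarrow> \<exists>t D E. 0 < t \<and> t < \<epsilon> \<and>
                  D\<^sup>2 \<le> a\<^sup>2 + t * X + t\<^sup>2 * K \<and> E\<^sup>2 \<le> b\<^sup>2 + t * Y + t\<^sup>2 * K \<and> a + b \<le> D + E"
  shows "0 \<le> b * X + a * Y"
proof (rule ccontr)
  assume neg: "\<not> 0 \<le> b * X + a * Y"
  define \<delta> where "\<delta> = - (b * X + a * Y)"
  have "\<delta> > 0" using neg by (simp add: \<delta>_def)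
  define M where "M = (a + b) * \<bar>K\<bar> + 1"
  have "M > 0" using assms(1,2) by (simp add: M_def add_nonneg_pos)
  have "\<delta> / M > 0" using \<open>\<delta> > 0\<close> \<open>M > 0\<close> by simp
  from approx[OF this] obtain t D E where t: "0 < t" "t < \<delta> / M"
    and D: "D\<^sup>2 \<le> a\<^sup>2 + t * X + t\<^sup>2 * K" and E: "E\<^sup>2 \<le> b\<^sup>2 + t * Y + t\<^sup>2 * K" and DE: "a + b \<le> D + E"
    by blast
  have "2 * a * D \<le> D\<^sup>2 + a\<^sup>2" using sum_squares_bound[of D a] by (simp add: algebra_simps)
  then have 1: "b * (2 * a * D) \<le> b * (2 * a\<^sup>2 + t * X + t\<^sup>2 * K)"
    using D \<open>b > 0\<close> by (intro mult_left_mono) auto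
  have "2 * b * E \<le> E\<^sup>2 + b\<^sup>2" using sum_squares_bound[of E b] by (simp add: algebra_simps)
  then have 2: "a * (2 * b * E) \<le> a * (2 * b\<^sup>2 + t * Y + t\<^sup>2 * K)"
    using E \<open>a > 0\<close> by (intro mult_left_mono) auto
  have "(2 * a * b) * (a + b) \<le> (2 * a * b) * (D + E)"
    using DE assms(1,2) by (intro mult_left_mono) auto
  with 1 2 have "0 \<le> t * (t * ((a + b) * K) - \<delta>)"
    by (simp add: \<delta>_def algebra_simps power2_eq_square)
  then have "\<delta> \<le> t * ((a + b) * K)" using t(1) by (simp add: zero_le_mult_iff)
  also have "\<dots> \<le> t * ((a + b) * \<bar>K\<bar>)" using t(1) assms(1,2) by (intro mult_left_mono) auto
  also have "\<dots> \<le> t * M" using t(1) by (simp add: M_def)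
  also have "\<dots> < \<delta>" using t(2) \<open>M > 0\<close> by (simp add: field_simps)
  finally show False by simp
qed

text \<open>
  The version of the inequality in terms of the ratio in which \<open>m\<close> divides the side; unlike the
  version with cleared denominators it can be passed to limits.
\<close>

lemma stewart_on_ratio:
  assumes "Metric_space X d" "stewart_on X d" and mem: "p \<in> X" "x \<in> X" "m \<in> X" "y \<in> X"
    and m: "d x m = t * d x y" "d m y = (1 - t) * d x y"
  shows "(d p m)\<^sup>2 \<le> (1 - t) * (d p x)\<^sup>2 + t * (d p y)\<^sup>2 - t * (1 - t) * (d x y)\<^sup>2"
proof -
  interpret Metric_space X d by fact
  show ?thesis
  proof (cases "d x y = 0")
    case True
    then have "x = y" "x = m" using mem m by auto
    then show ?thesis using mem by (simp add: left_diff_distrib)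
  next
    case False
    have "lies_between d x m y" using m by (simp add: lies_between_def algebra_simps)
    then have "stewart_ineq d p x m y" using assms(2) mem unfolding stewart_on_def by blast
    then have "d x y * (d p m)\<^sup>2 \<le> d x y * ((1 - t) * (d p x)\<^sup>2 + t * (d p y)\<^sup>2 - t * (1 - t) * (d x y)\<^sup>2)"
      unfolding stewart_ineq_def m by (simp add: algebra_simps power2_eq_square)
    then show ?thesis using False nonneg[of x y] by (simp add: less_le)
  qed
qed

text \<open>
  The metric is given on the union. The common part is convex in the sense of \<open>divS\<close>, and \<open>crossing\<close>
  says that a geodesic from one side to the other meets it.
\<close>

locale gluing =
  fixes A B :: "'a set" and d :: "'a \<Rightarrow> 'a \<Rightarrow> real"
  assumes metric: "Metric_space (A \<union> B) d"
    and stewartA: "stewart_on A d" and stewartB: "stewart_on B d"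
    and divA: "divisible_on A d" and divB: "divisible_on B d"
    and divS: "divisible_on (A \<inter> B) d"
    and crossing: "\<And>a b. \<lbrakk>a \<in> A; b \<in> B\<rbrakk> \<Longrightarrow> \<exists>s\<in>A \<inter> B. lies_between d a s b"
begin

interpretation Z: Metric_space "A \<union> B" d by (rule metric)

lemma stA: "\<lbrakk>p \<in> A; x \<in> A; n \<in> A; y \<in> A; d x y = d x n + d n y\<rbrakk> \<Longrightarrow>
    (d p n)\<^sup>2 * (d x n + d n y) \<le> (d p x)\<^sup>2 * d n y + (d p y)\<^sup>2 * d x n - d x n * d n y * (d x n + d n y)"
  using stewartA unfolding stewart_on_def lies_between_def stewart_ineq_def by blast

lemma stB: "\<lbrakk>p \<in> B; x \<in> B; n \<in> B; y \<in> B; d x y = d x n + d n y\<rbrakk> \<Longrightarrow>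
    (d p n)\<^sup>2 * (d x n + d n y) \<le> (d p x)\<^sup>2 * d n y + (d p y)\<^sup>2 * d x n - d x n * d n y * (d x n + d n y)"
  using stewartB unfolding stewart_on_def lies_between_def stewart_ineq_def by blast

lemma nn: "d x y \<ge> 0" by simp
lemma com: "d x y = d y x" by (rule Z.commute)
lemma tri: "\<lbrakk>x \<in> A \<union> B; y \<in> A \<union> B; z \<in> A \<union> B\<rbrakk> \<Longrightarrow> d x z \<le> d x y + d y z"
  by (rule Z.triangle)

text \<open>
  Both sides play the same role, so every result below may be used with \<open>A\<close> and \<open>B\<close> exchanged.
\<close>

lemma swap: "gluing B A d"
proof (rule gluing.intro)
  show "Metric_space (B \<union> A) d" by (simp add: Un_commute metric)
next
  fix a b assume "a \<in> B" "b \<in> A"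
  then obtain s where "s \<in> A \<inter> B" "lies_between d b s a" using crossing by blast
  then show "\<exists>s\<in>B \<inter> A. lies_between d a s b"
    using com unfolding lies_between_def by (metis add.commute inf_commute)
qed (use stewartA stewartB divA divB divS in \<open>auto simp: Int_commute\<close>)

text \<open>
  The point \<open>s\<close> is a crossing point of a geodesic from \<open>m\<close> to \<open>p\<close>. Moving it towards \<open>u\<close> inside the
  common part does not shorten the way from \<open>m\<close> to \<open>p\<close>, while Stewart's inequality on each side bounds the
  lengths of the two pieces from above. Comparing first derivatives at \<open>s\<close> gives the claim; in the
  language of angles, the comparison angles at \<open>s\<close> add up to at least \<open>\<pi>\<close>.
\<close>

lemma joint_apex_common:
  assumes "m \<in> A" "p \<in> B" "s \<in> A \<inter> B" "u \<in> A \<inter> B" "lies_between d m s p"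
  shows "stewart_ineq d u m s p"
proof (cases "d m s = 0 \<or> d s p = 0 \<or> u = s")
  case True
  have S: "m \<in> A \<union> B" "p \<in> A \<union> B" "s \<in> A \<union> B" using assms by auto
  show ?thesis using True
  proof (elim disjE)
    assume "d m s = 0" then have "m = s" using S by simp
    then show ?thesis using S by (simp add: stewart_ineq_def)
  next
    assume "d s p = 0" then have "p = s" using S by simp
    then show ?thesis using S by (simp add: stewart_ineq_def com)
  next
    assume "u = s"
    have "d m s * d s p * (d m s + d s p) \<le> (d m s)\<^sup>2 * d s p + (d s p)\<^sup>2 * d m s"
      by (simp add: algebra_simps power2_eq_square)
    then show ?thesis using S \<open>u = s\<close> by (simp add: stewart_ineq_def com[of s m])
  qed
next
  case False
  define a c r G E where "a = d m s" and "c = d s p" and "r = d s u" and "G = d u m" and "E = d u p"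
  have "a > 0" "c > 0" "r > 0" using False nn unfolding a_def c_def r_def
    using assms nn[of m s] nn[of s p] nn[of s u] Z.zero[of s u] by (auto simp: less_le)
  have "0 \<le> c * (G\<^sup>2 - a\<^sup>2 - r\<^sup>2) + a * (E\<^sup>2 - c\<^sup>2 - r\<^sup>2)"
  proof (rule first_variation_nonneg[where K = "r\<^sup>2"])
    fix \<epsilon> :: real assume "\<epsilon> > 0"
    define t where "t = min (\<epsilon> / 2) (1 / 2)"
    have t: "0 < t" "t < \<epsilon>" "t < 1" using \<open>\<epsilon> > 0\<close> by (auto simp: t_def min_def)
    obtain v where v: "v \<in> A \<inter> B" "d s v = t * r" "d v u = (1 - t) * r"
      using divS assms(3,4) t unfolding divisible_on_def r_def
      by (metis atLeastAtMost_iff less_eq_real_def)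
    have bet: "d s u = d s v + d v u" using v by (simp add: r_def algebra_simps)
    have "r * (d m v)\<^sup>2 \<le> r * (a\<^sup>2 + t * (G\<^sup>2 - a\<^sup>2 - r\<^sup>2) + t\<^sup>2 * r\<^sup>2)"
      using stA[OF assms(1) _ _ _ bet] v assms
      by (simp add: a_def G_def com[of m u] algebra_simps power2_eq_square)
    then have 1: "(d m v)\<^sup>2 \<le> a\<^sup>2 + t * (G\<^sup>2 - a\<^sup>2 - r\<^sup>2) + t\<^sup>2 * r\<^sup>2" using \<open>r > 0\<close> by simp
    have "r * (d p v)\<^sup>2 \<le> r * (c\<^sup>2 + t * (E\<^sup>2 - c\<^sup>2 - r\<^sup>2) + t\<^sup>2 * r\<^sup>2)"
      using stB[OF assms(2) _ _ _ bet] v assms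
      by (simp add: c_def E_def com[of p u] com[of p s] algebra_simps power2_eq_square)
    then have 2: "(d p v)\<^sup>2 \<le> c\<^sup>2 + t * (E\<^sup>2 - c\<^sup>2 - r\<^sup>2) + t\<^sup>2 * r\<^sup>2" using \<open>r > 0\<close> by simp
    have 3: "a + c \<le> d m v + d p v"
      using tri[of m v p] assms v com[of p v] by (auto simp: lies_between_def a_def c_def)
    show "\<exists>t D E'. 0 < t \<and> t < \<epsilon> \<and> D\<^sup>2 \<le> a\<^sup>2 + t * (G\<^sup>2 - a\<^sup>2 - r\<^sup>2) + t\<^sup>2 * r\<^sup>2 \<and>
            E'\<^sup>2 \<le> c\<^sup>2 + t * (E\<^sup>2 - c\<^sup>2 - r\<^sup>2) + t\<^sup>2 * r\<^sup>2 \<and> a + c \<le> D + E'"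
      using 1 2 3 t by blast
  qed (use \<open>a > 0\<close> \<open>c > 0\<close> in auto)
  then show ?thesis unfolding stewart_ineq_def a_def c_def r_def G_def E_def com[of u s]
    by (simp add: algebra_simps power2_eq_square)
qed

text \<open>
  The points that divide the diagonals \<open>s w\<close> and \<open>m u\<close> in the ratios \<open>\<alpha>\<close> and \<open>\<beta>\<close> have a nonnegative
  squared distance. Two applications of Stewart's inequality bound it from above, which is the
  claim.
\<close>

lemma weighted_quadrilateral:
  assumes "m \<in> A" "w \<in> A" "u \<in> A" "s \<in> A" "0 \<le> \<alpha>" "\<alpha> \<le> 1" "0 \<le> \<beta>" "\<beta> \<le> 1"
  shows "\<alpha> * (1 - \<alpha>) * (d s w)\<^sup>2 + \<beta> * (1 - \<beta>) * (d m u)\<^sup>2 \<le>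
      (1 - \<beta>) * ((1 - \<alpha>) * (d m s)\<^sup>2 + \<alpha> * (d m w)\<^sup>2) + \<beta> * ((1 - \<alpha>) * (d u s)\<^sup>2 + \<alpha> * (d u w)\<^sup>2)"
proof -
  have st: "(d p n)\<^sup>2 \<le> (1 - t) * (d p x)\<^sup>2 + t * (d p y)\<^sup>2 - t * (1 - t) * (d x y)\<^sup>2"
    if "p \<in> A" "x \<in> A" "n \<in> A" "y \<in> A" "d x n = t * d x y" "d n y = (1 - t) * d x y" for p x n y t
    by (rule stewart_on_ratio[OF Z.subspace[of A] stewartA that]) simp
  obtain y1 where y1: "y1 \<in> A" "d s y1 = \<alpha> * d s w" "d y1 w = (1 - \<alpha>) * d s w"
    using divA assms unfolding divisible_on_def by (metis atLeastAtMost_iff)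
  obtain y2 where y2: "y2 \<in> A" "d m y2 = \<beta> * d m u" "d y2 u = (1 - \<beta>) * d m u"
    using divA assms unfolding divisible_on_def by (metis atLeastAtMost_iff)
  have "0 \<le> (d y1 y2)\<^sup>2" by simp
  also have "\<dots> \<le> (1 - \<beta>) * (d y1 m)\<^sup>2 + \<beta> * (d y1 u)\<^sup>2 - \<beta> * (1 - \<beta>) * (d m u)\<^sup>2"
    using st[OF y1(1) assms(1) y2(1) assms(3) y2(2,3)] .
  finally have "\<beta> * (1 - \<beta>) * (d m u)\<^sup>2 \<le> (1 - \<beta>) * (d m y1)\<^sup>2 + \<beta> * (d u y1)\<^sup>2"
    by (simp add: com[of y1])
  also have "\<dots> \<le> (1 - \<beta>) * ((1 - \<alpha>) * (d m s)\<^sup>2 + \<alpha> * (d m w)\<^sup>2 - \<alpha> * (1 - \<alpha>) * (d s w)\<^sup>2) +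
      \<beta> * ((1 - \<alpha>) * (d u s)\<^sup>2 + \<alpha> * (d u w)\<^sup>2 - \<alpha> * (1 - \<alpha>) * (d s w)\<^sup>2)"
    using st[OF assms(1,4) y1(1) assms(2) y1(2,3)] st[OF assms(3,4) y1(1) assms(2) y1(2,3)] assms(7,8)
    by (intro add_mono mult_left_mono) auto
  finally show ?thesis by (simp add: algebra_simps)
qed

text \<open>
  This replaces Alexandrov's lemma on adjacent triangles. Let \<open>u\<close> be the crossing point of a geodesic
  from \<open>w\<close> to \<open>p\<close>. If everything were flat, then \<open>p\<close> would lie on the line through \<open>m\<close> and \<open>s\<close> and on the
  line through \<open>w\<close> and \<open>u\<close>; eliminating \<open>p\<close> gives an affine relation between \<open>m\<close>, \<open>s\<close>, \<open>u\<close>, \<open>w\<close> which says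
  in which ratios the diagonals \<open>s w\<close> and \<open>m u\<close> of the quadrilateral intersect. With exactly these
  ratios, \<open>weighted_quadrilateral\<close> and the lower bound for \<open>d u m\<close> from \<open>joint_apex_common\<close>
  combine to the claim.
\<close>

lemma joint_stewart:
  assumes "m \<in> A" "p \<in> B" "s \<in> A \<inter> B" "w \<in> A" "lies_between d m s p"
  shows "stewart_ineq d w m s p"
proof -
  obtain u where u: "u \<in> A \<inter> B" "d w p = d w u + d u p"
    using crossing[OF assms(4,2)] by (auto simp: lies_between_def)
  define a c r G E h k e where "a = d m s" and "c = d s p" and "r = d s u" and "G = d u m"
    and "E = d u p" and "h = d w s" and "k = d w u" and "e = d w m"
  have nonneg: "a \<ge> 0" "c \<ge> 0" "k \<ge> 0" "E \<ge> 0" unfolding a_def c_def k_def E_def by auto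
  show ?thesis
  proof (cases "a = 0 \<or> c = 0 \<or> k = 0 \<or> E = 0")
    case True
    have mem: "m \<in> A \<union> B" "p \<in> A \<union> B" "s \<in> A \<union> B" "w \<in> A \<union> B" "u \<in> A \<union> B"
      using assms u by auto
    from True consider "m = s" | "p = s" | "w = u" | "u = p"
      unfolding a_def c_def k_def E_def
      using Z.zero[of m s] Z.zero[of s p] Z.zero[of w u] Z.zero[of u p] mem by auto
    then show ?thesis
    proof cases
      case 1 then show ?thesis using assms by (simp add: stewart_ineq_def)
    next
      case 2 then show ?thesis using assms by (simp add: stewart_ineq_def)
    next
      case 3 then show ?thesis using joint_apex_common[OF assms(1-3) u(1) assms(5)] by simp
    next
      case 4
      then have "p \<in> A" using u(1) by simp
      then show ?thesis
        using stA[of w m s p] assms unfolding stewart_ineq_def lies_between_def by simp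
    qed
  next
    case False
    then have pos: "a > 0" "c > 0" "k > 0" "E > 0" using nonneg by auto
    \<comment> \<open>In the flat case \<open>(1 + P) s + Q w = P m + (1 + Q) u\<close>, with total weight \<open>W\<close> on both sides.\<close>
    define P Q W where "P = c / a" and "Q = E / k" and "W = 1 + P + Q"
    have PQ: "P > 0" "Q > 0" "W > 0" using pos by (auto simp: P_def Q_def W_def add_pos_pos)
    have cP: "c = P * a" and EQ: "E = Q * k" using pos by (auto simp: P_def Q_def)
    define \<alpha> \<beta> where "\<alpha> = Q / W" and "\<beta> = (1 + Q) / W"
    have co: "1 - \<alpha> = (1 + P) / W" "1 - \<beta> = P / W"
      using PQ by (auto simp: \<alpha>_def \<beta>_def W_def field_simps)
    have range: "0 \<le> \<alpha>" "\<alpha> \<le> 1" "0 \<le> \<beta>" "\<beta> \<le> 1"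
      using PQ by (auto simp: \<alpha>_def \<beta>_def W_def)
    have J: "G\<^sup>2 * c + E\<^sup>2 * a \<ge> (r\<^sup>2 + a * c) * (a + c)"
      using joint_apex_common[OF assms(1-3) u(1) assms(5)]
      unfolding stewart_ineq_def a_def c_def r_def G_def E_def com[of u s] by (simp add: algebra_simps)
    have "a * (G\<^sup>2 * P + E\<^sup>2) \<ge> a * ((r\<^sup>2 + P * a\<^sup>2) * (1 + P))"
      using J unfolding cP by (simp add: algebra_simps power2_eq_square)
    then have J': "G\<^sup>2 * P + E\<^sup>2 \<ge> (r\<^sup>2 + P * a\<^sup>2) * (1 + P)" using pos by simp
    have "\<alpha> * (1 - \<alpha>) * h\<^sup>2 + \<beta> * (1 - \<beta>) * G\<^sup>2 \<le>
        (1 - \<beta>) * ((1 - \<alpha>) * a\<^sup>2 + \<alpha> * e\<^sup>2) + \<beta> * ((1 - \<alpha>) * r\<^sup>2 + \<alpha> * k\<^sup>2)"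
      using weighted_quadrilateral[of m w u s \<alpha> \<beta>] assms u range
      unfolding h_def G_def a_def e_def r_def k_def
      by (simp add: com[of w s] com[of m u] com[of w m] com[of s u] com[of w u])
    then have "W\<^sup>2 * (\<alpha> * (1 - \<alpha>) * h\<^sup>2 + \<beta> * (1 - \<beta>) * G\<^sup>2) \<le>
        W\<^sup>2 * ((1 - \<beta>) * ((1 - \<alpha>) * a\<^sup>2 + \<alpha> * e\<^sup>2) + \<beta> * ((1 - \<alpha>) * r\<^sup>2 + \<alpha> * k\<^sup>2))"
      by (intro mult_left_mono) auto
    moreover have "W\<^sup>2 * (\<alpha> * (1 - \<alpha>) * h\<^sup>2 + \<beta> * (1 - \<beta>) * G\<^sup>2) =
        (W * \<alpha>) * (W * (1 - \<alpha>)) * h\<^sup>2 + (W * \<beta>) * (W * (1 - \<beta>)) * G\<^sup>2"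
      by (simp add: distrib_left power2_eq_square)
    moreover have "W\<^sup>2 * ((1 - \<beta>) * ((1 - \<alpha>) * a\<^sup>2 + \<alpha> * e\<^sup>2) + \<beta> * ((1 - \<alpha>) * r\<^sup>2 + \<alpha> * k\<^sup>2)) =
        (W * (1 - \<beta>)) * ((W * (1 - \<alpha>)) * a\<^sup>2 + (W * \<alpha>) * e\<^sup>2) +
        (W * \<beta>) * ((W * (1 - \<alpha>)) * r\<^sup>2 + (W * \<alpha>) * k\<^sup>2)"
      by (simp add: distrib_left power2_eq_square)
    moreover have "W * \<alpha> = Q" "W * (1 - \<alpha>) = 1 + P" "W * \<beta> = 1 + Q" "W * (1 - \<beta>) = P"
      unfolding co unfolding \<alpha>_def \<beta>_def using PQ by auto
    ultimately have quad: "Q * (1 + P) * h\<^sup>2 + (1 + Q) * (P * G\<^sup>2) \<le>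
        P * ((1 + P) * a\<^sup>2 + Q * e\<^sup>2) + (1 + Q) * ((1 + P) * r\<^sup>2 + Q * k\<^sup>2)"
      by (simp only: mult.assoc)
    have "(1 + Q) * ((r\<^sup>2 + P * a\<^sup>2) * (1 + P) - E\<^sup>2) \<le> (1 + Q) * (P * G\<^sup>2)"
      using J' PQ by (intro mult_left_mono) (auto simp: algebra_simps)
    with quad have "Q * ((1 + P) * h\<^sup>2) \<le>
        Q * (P * e\<^sup>2 + (k + E)\<^sup>2 - P * a\<^sup>2 * (1 + P))"
      unfolding EQ by (simp add: algebra_simps power2_eq_square)
    then have "(1 + P) * h\<^sup>2 \<le> P * e\<^sup>2 + (k + E)\<^sup>2 - P * a\<^sup>2 * (1 + P)" using PQ by simp
    then have "a * ((1 + P) * h\<^sup>2) \<le> a * (P * e\<^sup>2 + (k + E)\<^sup>2 - P * a\<^sup>2 * (1 + P))"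
      using pos by (intro mult_left_mono) auto
    then have "h\<^sup>2 * (a + c) \<le> e\<^sup>2 * c + (k + E)\<^sup>2 * a - a * c * (a + c)"
      unfolding cP by (simp add: algebra_simps power2_eq_square)
    then show ?thesis
      using u(2) unfolding stewart_ineq_def h_def a_def c_def e_def k_def E_def by simp
  qed
qed

text \<open>
  Convexity of \<open>A\<close> in the union. A point \<open>n\<close> outside \<open>A\<close> would lie between two points of the common
  part, since a geodesic through \<open>n\<close> has to leave \<open>A\<close> and to return. But these two points are also
  joined inside the common part, and geodesics in \<open>B\<close> are unique.
\<close>

lemma lies_between_memA:
  assumes "x \<in> A" "y \<in> A" "n \<in> A \<union> B" "lies_between d x n y"
  shows "n \<in> A"
proof (rule ccontr)
  assume "n \<notin> A"
  then have nB: "n \<in> B" using assms(3) by simp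
  obtain s where s: "s \<in> A \<inter> B" "d x n = d x s + d s n"
    using crossing[OF assms(1) nB] by (auto simp: lies_between_def)
  obtain s' where s': "s' \<in> A \<inter> B" "d n y = d n s' + d s' y"
    using crossing[OF assms(2) nB] com unfolding lies_between_def by (metis add.commute)
  have "d x y \<le> d x s + d s s' + d s' y"
    using tri[of x s y] tri[of s s' y] assms s s' by auto
  then have bet: "d s s' = d s n + d n s'"
    using assms(4) s s' tri[of s n s'] assms(3) unfolding lies_between_def by auto
  define t where "t = d s n / d s s'"
  have pos: "d s s' > 0"
  proof (rule ccontr)
    assume "\<not> d s s' > 0"
    then have "d s n = 0" using bet nn[of s n] nn[of n s'] by linarith
    then show False using s(1) nB \<open>n \<notin> A\<close> by auto
  qed
  have t: "0 \<le> t" "t \<le> 1" "t * d s s' = d s n" "(1 - t) * d s s' = d n s'"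
    using pos bet nn[of s n] nn[of n s'] by (auto simp: t_def field_simps)
  obtain v where v: "v \<in> A \<inter> B" "d s v = d s n" "d v s' = d n s'"
    using divS s(1) s'(1) t unfolding divisible_on_def by (metis atLeastAtMost_iff)
  have "(d v n)\<^sup>2 * (d s n + d n s') \<le> 0"
    using stB[OF _ _ nB _ bet, of v] v s s' nB com[of v s]
    by (simp add: algebra_simps power2_eq_square)
  then have "d v n = 0" using bet pos by (simp add: mult_le_0_iff)
  then show False using v(1) nB \<open>n \<notin> A\<close> by auto
qed

text \<open>
  The inequality at \<open>n\<close> with apex \<open>s\<close> holds in \<open>A\<close>. It is extended from \<open>s\<close> to \<open>p\<close> along the geodesic
  from \<open>n\<close> through \<open>s\<close> by using \<open>joint_stewart\<close> with the apices \<open>x\<close> and \<open>y\<close>. The result carries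
  a factor \<open>d n s\<close>, which has to be cancelled; hence the last assumption.
\<close>

lemma far_apex_off_junction:
  assumes "x \<in> A" "y \<in> A" "n \<in> A" "p \<in> B" "lies_between d x n y"
    and "s \<in> A \<inter> B" "lies_between d n s p" "d n s > 0"
  shows "stewart_ineq d p x n y"
proof -
  define a c e1 e2 X Y f g where "a = d n s" and "c = d s p" and "e1 = d x n" and "e2 = d n y"
    and "X = d p x" and "Y = d p y" and "f = d x s" and "g = d y s"
  have pos: "a > 0" "c \<ge> 0" "e1 \<ge> 0" "e2 \<ge> 0" using assms(8) by (auto simp: a_def c_def e1_def e2_def)
  have pn: "d p n = a + c" using assms(7) com[of p n] by (simp add: lies_between_def a_def c_def)
  have 1: "f\<^sup>2 * (a + c) \<le> e1\<^sup>2 * c + X\<^sup>2 * a - a * c * (a + c)"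
    using joint_stewart[OF assms(3,4,6,1,7)] com[of x p]
    unfolding stewart_ineq_def a_def c_def e1_def X_def f_def by simp
  have 2: "g\<^sup>2 * (a + c) \<le> e2\<^sup>2 * c + Y\<^sup>2 * a - a * c * (a + c)"
    using joint_stewart[OF assms(3,4,6,2,7)] com[of y p] com[of y n]
    unfolding stewart_ineq_def a_def c_def e2_def Y_def g_def by simp
  have 3: "a\<^sup>2 * (e1 + e2) \<le> f\<^sup>2 * e2 + g\<^sup>2 * e1 - e1 * e2 * (e1 + e2)"
    using stA[of s x n y] assms com[of s n] com[of s x] com[of s y]
    unfolding lies_between_def a_def e1_def e2_def f_def g_def by auto
  have "(a + c) * (a\<^sup>2 * (e1 + e2)) \<le> (a + c) * (f\<^sup>2 * e2 + g\<^sup>2 * e1 - e1 * e2 * (e1 + e2))"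
    using 3 pos by (intro mult_left_mono) auto
  moreover have "e2 * (f\<^sup>2 * (a + c)) \<le> e2 * (e1\<^sup>2 * c + X\<^sup>2 * a - a * c * (a + c))"
    using 1 pos by (intro mult_left_mono) auto
  moreover have "e1 * (g\<^sup>2 * (a + c)) \<le> e1 * (e2\<^sup>2 * c + Y\<^sup>2 * a - a * c * (a + c))"
    using 2 pos by (intro mult_left_mono) auto
  ultimately have "a * ((a + c)\<^sup>2 * (e1 + e2)) \<le> a * (X\<^sup>2 * e2 + Y\<^sup>2 * e1 - e1 * e2 * (e1 + e2))"
    by (simp add: algebra_simps power2_eq_square)
  then have "(a + c)\<^sup>2 * (e1 + e2) \<le> X\<^sup>2 * e2 + Y\<^sup>2 * e1 - e1 * e2 * (e1 + e2)" using pos by simp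
  then show ?thesis unfolding stewart_ineq_def pn by (simp add: e1_def e2_def X_def Y_def)
qed

text \<open>
  Preparation of the case in which \<open>n\<close> itself belongs to the common part: close to \<open>n\<close> there are
  points \<open>q\<close> between \<open>n\<close> and \<open>p\<close> at which the inequality is already known for the apices \<open>x\<close> and \<open>y\<close>.
  If a geodesic from \<open>n\<close> to \<open>p\<close> starts inside the common part, then \<open>q\<close> can be taken as a crossing
  point; otherwise \<open>q\<close> lies off the common part and \<open>far_apex_off_junction\<close> applies with the two
  sides exchanged.
\<close>

lemma far_apex_nearby_points:
  assumes "x \<in> A" "y \<in> A" "n \<in> A \<inter> B" "p \<in> B" "d n p > 0" "\<epsilon> > 0"
  shows "\<exists>t q. 0 < t \<and> t < \<epsilon> \<and> q \<in> B \<and> d n q = t * d n p \<and> d q p = (1 - t) * d n p \<and>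
           stewart_ineq d x n q p \<and> stewart_ineq d y n q p"
proof (cases "\<exists>q0\<in>A \<inter> B. q0 \<noteq> n \<and> lies_between d n q0 p")
  case True
  then obtain q0 where q0: "q0 \<in> A \<inter> B" "q0 \<noteq> n" "d n p = d n q0 + d q0 p"
    by (auto simp: lies_between_def)
  have "d n q0 > 0" using q0 assms(3) Z.mdist_pos_less[of n q0] by auto
  define \<mu> where "\<mu> = min (\<epsilon> / 2) (1 / 2)"
  have \<mu>: "0 < \<mu>" "\<mu> < \<epsilon>" "\<mu> < 1" using assms(6) by (auto simp: \<mu>_def min_def)
  obtain q where q: "q \<in> A \<inter> B" "d n q = \<mu> * d n q0" "d q q0 = (1 - \<mu>) * d n q0"
    using divS assms(3) q0(1) \<mu> unfolding divisible_on_def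
    by (metis atLeastAtMost_iff less_eq_real_def)
  define t where "t = \<mu> * (d n q0 / d n p)"
  have r: "0 < d n q0 / d n p" "d n q0 / d n p \<le> 1"
    using q0(3) \<open>d n q0 > 0\<close> assms(5) nn[of q0 p] by (simp_all only: zero_less_divide_iff divide_le_eq_1_pos) auto
  have t: "0 < t" "t < \<epsilon>" "d n q = t * d n p"
    using \<mu> assms(5) mult_left_le[OF r(2), of \<mu>] mult_pos_pos[OF \<mu>(1) r(1)] q(2)
    unfolding t_def by auto
  have "d q p = d n p - d n q"
    using tri[of q q0 p] tri[of n q p] q q0 assms by (auto simp: algebra_simps)
  then have "d q p = (1 - t) * d n p" using t(3) by (simp add: algebra_simps)
  moreover from \<open>d q p = d n p - d n q\<close> have "lies_between d n q p" by (simp add: lies_between_def)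
  ultimately show ?thesis
    using joint_stewart[of n p q] assms q t by blast
next
  case False
  define t where "t = min (\<epsilon> / 2) (1 / 2)"
  have t: "0 < t" "t < \<epsilon>" "t < 1" using assms(6) by (auto simp: t_def min_def)
  obtain q where q: "q \<in> B" "d n q = t * d n p" "d q p = (1 - t) * d n p"
    using divB assms(3,4) t unfolding divisible_on_def
    by (metis IntD2 atLeastAtMost_iff less_eq_real_def)
  have bet: "lies_between d n q p" using q by (simp add: lies_between_def algebra_simps)
  have "q \<noteq> n"
  proof
    assume "q = n"
    then have "d n q = 0" using assms(3) by auto
    then show False using q(2) t assms(5) by simp
  qed
  then have qA: "q \<notin> A" using False bet q(1) by blast
  interpret swapped: gluing B A d by (rule swap)
  have *: "stewart_ineq d z n q p" if "z \<in> A" for z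
  proof -
    obtain s where s: "s \<in> B \<inter> A" "lies_between d q s z"
      using swapped.crossing[OF q(1) \<open>z \<in> A\<close>] by blast
    have "d q s > 0" using s qA q(1) Z.mdist_pos_less[of q s] by auto
    then show ?thesis
      using swapped.far_apex_off_junction[OF _ assms(4) q(1) that bet s] assms(3) by blast
  qed
  then show ?thesis using assms q t by blast
qed

text \<open>
  If \<open>n\<close> belongs to the common part, the inequality follows from \<open>d x y \<le> d x q + d q y\<close> for the
  points \<open>q\<close> between \<open>n\<close> and \<open>p\<close> found above, by letting \<open>q\<close> tend to \<open>n\<close>.
\<close>

lemma far_apex:
  assumes "x \<in> A" "y \<in> A" "p \<in> B" "n \<in> A" "lies_between d x n y"
  shows "stewart_ineq d p x n y"
proof -
  obtain s where s: "s \<in> A \<inter> B" "lies_between d n s p" using crossing[OF assms(4,3)] by blast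
  show ?thesis
  proof (cases "n = s")
    case False
    then have "d n s > 0" using s assms Z.mdist_pos_less[of n s] by auto
    then show ?thesis using far_apex_off_junction[OF assms(1,2,4,3,5) s] by blast
  next
    case True
    then have nS: "n \<in> A \<inter> B" using s by simp
    show ?thesis
    proof (cases "x = n \<or> y = n \<or> p = n")
      case True
      then show ?thesis
      proof (elim disjE)
        assume "p = n"
        have "d x n * d n y * (d x n + d n y) = (d x n)\<^sup>2 * d n y + (d n y)\<^sup>2 * d x n"
          by (simp add: algebra_simps power2_eq_square)
        then show ?thesis using nS \<open>p = n\<close> com[of n x] by (simp add: stewart_ineq_def)
      qed (use nS in \<open>auto simp: stewart_ineq_def\<close>)
    next
      case False
      define c e1 e2 X Y where "c = d n p" and "e1 = d x n" and "e2 = d n y"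
        and "X = d p x" and "Y = d p y"
      have pos: "c > 0" "e1 > 0" "e2 > 0"
        using False assms nS Z.mdist_pos_less[of n p] Z.mdist_pos_less[of x n] Z.mdist_pos_less[of n y]
        unfolding c_def e1_def e2_def by auto
      have "0 \<le> e2 * (X\<^sup>2 - e1\<^sup>2 - c\<^sup>2) + e1 * (Y\<^sup>2 - e2\<^sup>2 - c\<^sup>2)"
      proof (rule first_variation_nonneg[where K = "c\<^sup>2"])
        fix \<epsilon> :: real assume "\<epsilon> > 0"
        then obtain t q where t: "0 < t" "t < \<epsilon>" and q: "q \<in> B" "d n q = t * c" "d q p = (1 - t) * c"
          and st: "stewart_ineq d x n q p" "stewart_ineq d y n q p"
          using far_apex_nearby_points[OF assms(1,2) nS assms(3)] pos(1) unfolding c_def by blast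
        have sum: "d n q + d q p = c" using q by (simp add: algebra_simps)
        have "c * (d x q)\<^sup>2 \<le> c * (e1\<^sup>2 + t * (X\<^sup>2 - e1\<^sup>2 - c\<^sup>2) + t\<^sup>2 * c\<^sup>2)"
          using st(1) com[of x p] unfolding stewart_ineq_def sum q(2,3) e1_def[symmetric] X_def
          by (simp add: algebra_simps power2_eq_square)
        moreover have "c * (d y q)\<^sup>2 \<le> c * (e2\<^sup>2 + t * (Y\<^sup>2 - e2\<^sup>2 - c\<^sup>2) + t\<^sup>2 * c\<^sup>2)"
          using st(2) com[of y p] com[of y n] unfolding stewart_ineq_def sum q(2,3) e2_def Y_def
          by (simp add: algebra_simps power2_eq_square)
        moreover have "e1 + e2 \<le> d x q + d y q"
          using tri[of x q y] assms q(1) com[of y q] by (auto simp: lies_between_def e1_def e2_def)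
        ultimately show "\<exists>t D E. 0 < t \<and> t < \<epsilon> \<and> D\<^sup>2 \<le> e1\<^sup>2 + t * (X\<^sup>2 - e1\<^sup>2 - c\<^sup>2) + t\<^sup>2 * c\<^sup>2 \<and>
            E\<^sup>2 \<le> e2\<^sup>2 + t * (Y\<^sup>2 - e2\<^sup>2 - c\<^sup>2) + t\<^sup>2 * c\<^sup>2 \<and> e1 + e2 \<le> D + E"
          using t pos(1) by (meson mult_le_cancel_left_pos)
      qed (use pos in auto)
      then show ?thesis
        using com[of p n] unfolding stewart_ineq_def c_def e1_def e2_def X_def Y_def
        by (simp add: algebra_simps power2_eq_square)
    qed
  qed
qed

text \<open>
  Choose a crossing point \<open>s\<close> between \<open>n\<close> and \<open>y\<close>. The inequality for \<open>x\<close>, \<open>s\<close>, \<open>y\<close> is \<open>joint_stewart\<close>,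
  the one for \<open>x\<close>, \<open>n\<close>, \<open>s\<close> takes place in \<open>A\<close>, and together they give the one for \<open>x\<close>, \<open>n\<close>, \<open>y\<close>.
\<close>

lemma glued_stewart_across:
  assumes "p \<in> A \<union> B" "x \<in> A" "y \<in> B" "n \<in> A" "lies_between d x n y"
  shows "stewart_ineq d p x n y"
proof -
  interpret swapped: gluing B A d by (rule swap)
  obtain s where s: "s \<in> A \<inter> B" "d n y = d n s + d s y"
    using crossing[OF assms(4,3)] by (auto simp: lies_between_def)
  have xsy: "lies_between d x s y" and xns: "lies_between d x n s"
    using s assms tri[of x n s] tri[of x s y] unfolding lies_between_def by auto
  have 1: "stewart_ineq d p x s y"
  proof (cases "p \<in> A")
    case True
    then show ?thesis using joint_stewart[OF assms(2,3) s(1) _ xsy] by blast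
  next
    case False
    then have "p \<in> B" using assms by simp
    have "lies_between d y s x" using xsy com unfolding lies_between_def by (metis add.commute)
    then have "stewart_ineq d p y s x"
      using swapped.joint_stewart[OF assms(3,2) _ \<open>p \<in> B\<close>] s by blast
    then show ?thesis using com[of y s] com[of s x] unfolding stewart_ineq_def by (simp add: algebra_simps)
  qed
  have 2: "stewart_ineq d p x n s"
  proof (cases "p \<in> A")
    case True
    then show ?thesis using stewartA assms s xns unfolding stewart_on_def by blast
  next
    case False
    then have "p \<in> B" using assms by simp
    then show ?thesis using far_apex[OF assms(2) _ _ assms(4) xns] s by blast
  qed
  show ?thesis
  proof (cases "d x s = 0")
    case True
    then have "d x n = 0" using xns nn[of x n] nn[of n s] unfolding lies_between_def by linarith
    then have "n = x" using assms Z.zero[of x n] by auto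
    then show ?thesis using assms by (simp add: stewart_ineq_def)
  next
    case False
    define u v w where "u = d x n" and "v = d n s" and "w = d s y"
    have nonneg: "u \<ge> 0" "v \<ge> 0" "w \<ge> 0" by (auto simp: u_def v_def w_def)
    have uv: "d x s = u + v" using xns by (simp add: lies_between_def u_def v_def)
    have "u + v > 0" using False uv nonneg by auto
    have st1: "(d p s)\<^sup>2 * (u + v + w) \<le> (d p x)\<^sup>2 * w + (d p y)\<^sup>2 * (u + v) - (u + v) * w * (u + v + w)"
      using 1 unfolding stewart_ineq_def uv w_def[symmetric] by simp
    have st2: "(d p n)\<^sup>2 * (u + v) \<le> (d p x)\<^sup>2 * v + (d p s)\<^sup>2 * u - u * v * (u + v)"
      using 2 unfolding stewart_ineq_def u_def v_def by simp
    have "u * ((d p s)\<^sup>2 * (u + v + w)) \<le> u * ((d p x)\<^sup>2 * w + (d p y)\<^sup>2 * (u + v) - (u + v) * w * (u + v + w))"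
      using st1 nonneg by (intro mult_left_mono) auto
    moreover have "(u + v + w) * ((d p n)\<^sup>2 * (u + v)) \<le> (u + v + w) * ((d p x)\<^sup>2 * v + (d p s)\<^sup>2 * u - u * v * (u + v))"
      using st2 nonneg by (intro mult_left_mono) auto
    ultimately have "(u + v) * ((d p n)\<^sup>2 * (u + (v + w))) \<le>
        (u + v) * ((d p x)\<^sup>2 * (v + w) + (d p y)\<^sup>2 * u - u * (v + w) * (u + (v + w)))"
      by (simp add: algebra_simps power2_eq_square)
    then have "(d p n)\<^sup>2 * (u + (v + w)) \<le> (d p x)\<^sup>2 * (v + w) + (d p y)\<^sup>2 * u - u * (v + w) * (u + (v + w))"
      using \<open>u + v > 0\<close> by simp
    then show ?thesis unfolding stewart_ineq_def s(2) u_def v_def w_def .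
  qed
qed

lemma stewart_ineq_commute: "stewart_ineq d p x n y \<longleftrightarrow> stewart_ineq d p y n x"
  using com[of y n] com[of n x] unfolding stewart_ineq_def by (simp add: algebra_simps)

lemma lies_between_commute: "lies_between d x n y \<longleftrightarrow> lies_between d y n x"
  using com[of y n] com[of n x] com[of x y] unfolding lies_between_def by auto

theorem glued_stewart: "stewart_on (A \<union> B) d"
  unfolding stewart_on_def
proof (intro ballI impI)
  fix p x n y assume m: "p \<in> A \<union> B" "x \<in> A \<union> B" "n \<in> A \<union> B" "y \<in> A \<union> B" and b: "lies_between d x n y"
  interpret swapped: gluing B A d by (rule swap)
  have b': "lies_between d y n x" using b lies_between_commute by simp
  have same: "stewart_ineq d p x n y" if "x \<in> A" "y \<in> A"
  proof -
    have "n \<in> A" using lies_between_memA[OF that m(3) b] .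
    then show ?thesis
      using m(1) that b far_apex[OF that _ _ b] stewartA unfolding stewart_on_def by blast
  qed
  have same': "stewart_ineq d p x n y" if "x \<in> B" "y \<in> B"
  proof -
    have "n \<in> B" using swapped.lies_between_memA[OF that _ b] m(3) by blast
    then show ?thesis
      using m(1) that b swapped.far_apex[OF that _ _ b] stewartB unfolding stewart_on_def by blast
  qed
  have mixed: "stewart_ineq d p x n y" if "x \<in> A" "y \<in> B"
    using m b b' that glued_stewart_across[of p x y n] swapped.glued_stewart_across[of p y x n]
      stewart_ineq_commute by blast
  have mixed': "stewart_ineq d p x n y" if "x \<in> B" "y \<in> A"
    using m b b' that glued_stewart_across[of p y x n] swapped.glued_stewart_across[of p x y n]
      stewart_ineq_commute by blast
  show "stewart_ineq d p x n y" using same same' mixed mixed' m by blast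
qed

lemma divisible_across:
  assumes "x \<in> A" "y \<in> B" "0 \<le> t" "t \<le> 1" "t * d x y \<le> d x s" "s \<in> A \<inter> B" "lies_between d x s y"
  shows "\<exists>m\<in>A. d x m = t * d x y \<and> d m y = (1 - t) * d x y"
proof (cases "d x s = 0")
  case True
  then have "t * d x y = 0" using assms(3,5) nn[of x y] mult_nonneg_nonneg[of t "d x y"] by linarith
  then have "d x x = t * d x y" "d x y = (1 - t) * d x y" using assms(1) by (auto simp: left_diff_distrib)
  then show ?thesis using assms(1) by blast
next
  case False
  then have pos: "d x s > 0" using nn[of x s] by linarith
  define t' where "t' = t * d x y / d x s"
  have "0 \<le> t'" "t' \<le> 1" using assms pos by (auto simp: t'_def)
  then obtain m where m: "m \<in> A" "d x m = t' * d x s" "d m s = (1 - t') * d x s"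
    using divA assms unfolding divisible_on_def by (metis IntD1 atLeastAtMost_iff)
  have 1: "d x m = t * d x y" using m(2) pos by (simp add: t'_def)
  have 2: "d m s = d x s - t * d x y" using m(3) pos by (simp add: t'_def algebra_simps)
  have "d m y = d x y - t * d x y"
    using tri[of m s y] tri[of x m y] 1 2 m(1) assms unfolding lies_between_def by auto
  then show ?thesis using 1 m(1) by (auto simp: algebra_simps)
qed

theorem glued_divisible: "divisible_on (A \<union> B) d"
  unfolding divisible_on_def
proof (intro ballI)
  fix x y and t :: real assume m: "x \<in> A \<union> B" "y \<in> A \<union> B" "t \<in> {0..1}"
  interpret swapped: gluing B A d by (rule swap)
  have across: "\<exists>m\<in>A \<union> B. d x m = t * d x y \<and> d m y = (1 - t) * d x y"
    if xy: "x \<in> A" "y \<in> B" "t \<in> {0..1}" for x y t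
  proof -
    obtain s where s: "s \<in> A \<inter> B" "lies_between d x s y" using crossing[OF xy(1,2)] by blast
    show ?thesis
    proof (cases "t * d x y \<le> d x s")
      case True
      then show ?thesis using divisible_across[OF xy(1,2) _ _ True s] xy(3) by auto
    next
      case False
      have "(1 - t) * d y x \<le> d y s" using False s com[of y x] com[of y s]
        by (simp add: lies_between_def algebra_simps)
      then obtain m where "m \<in> B" "d y m = (1 - t) * d y x" "d m x = (1 - (1 - t)) * d y x"
        using swapped.divisible_across[OF xy(2,1), of "1 - t" s] s xy(3)
          lies_between_commute[of x s y] by auto
      then show ?thesis using com[of y x] com[of y m] com[of m x] by auto
    qed
  qed
  consider "x \<in> A" "y \<in> A" | "x \<in> B" "y \<in> B" | "x \<in> A" "y \<in> B" | "x \<in> B" "y \<in> A" using m by blast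
  then show "\<exists>m\<in>A \<union> B. d x m = t * d x y \<and> d m y = (1 - t) * d x y"
  proof cases
    case 1 then show ?thesis using divA m(3) unfolding divisible_on_def by blast
  next
    case 2 then show ?thesis using divB m(3) unfolding divisible_on_def by blast
  next
    case 3 then show ?thesis using across m(3) by blast
  next
    case 4
    then obtain m where "m \<in> A \<union> B" "d y m = (1 - t) * d y x" "d m x = (1 - (1 - t)) * d y x"
      using across[of y x "1 - t"] m(3) by auto
    then show ?thesis using com[of y x] com[of y m] com[of m x] by auto
  qed
qed

end

section \<open>Distances measured by Lipschitz curves\<close>

text \<open>
  A curve of length at most \<open>L\<close>, described without mentioning length: it is \<open>1\<close>-Lipschitz on an
  interval of length \<open>L\<close>. Such curves are easily concatenated and cut, and they are closed under uniform
  limits.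
\<close>

definition reach :: "complex set \<Rightarrow> complex \<Rightarrow> complex \<Rightarrow> real \<Rightarrow> bool" where
  "reach P x y L \<longleftrightarrow>
     0 \<le> L \<and> (\<exists>g. 1-lipschitz_on {0..L} g \<and> g ` {0..L} \<subseteq> P \<and> g 0 = x \<and> g L = y)"

text \<open>
  The value \<open>0\<close> for points that cannot be joined agrees with the convention of \<^const>\<open>length_metric\<close>,
  so that both functions coincide everywhere (\<open>length_metric_eq_lipdist\<close>).
\<close>

definition lipdist :: "complex set \<Rightarrow> complex \<Rightarrow> complex \<Rightarrow> real" where
  "lipdist P x y = (if \<exists>L. reach P x y L then Inf {L. reach P x y L} else 0)"

definition lip_connected :: "complex set \<Rightarrow> bool" where
  "lip_connected P \<longleftrightarrow> (\<forall>x\<in>P. \<forall>y\<in>P. \<exists>L. reach P x y L)"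

lemma reachI:
  assumes "1-lipschitz_on {a..b} g" "a \<le> b" "g ` {a..b} \<subseteq> P"
  shows "reach P (g a) (g b) (b - a)"
  unfolding reach_def
proof (intro conjI exI)
  show "1-lipschitz_on {0..b - a} (\<lambda>t. g (a + t))"
  proof (rule lipschitz_onI)
    fix s t assume "s \<in> {0..b - a}" "t \<in> {0..b - a}"
    then show "dist (g (a + s)) (g (a + t)) \<le> 1 * dist s t"
      using lipschitz_onD[OF assms(1), of "a + s" "a + t"] by (auto simp: dist_real_def)
  qed simp
  show "(\<lambda>t. g (a + t)) ` {0..b - a} \<subseteq> P" using assms(3) by auto
qed (use assms in auto)

lemma reach_nonneg: "reach P x y L \<Longrightarrow> 0 \<le> L"
  by (simp add: reach_def)

lemma reach_subset: "reach P x y L \<Longrightarrow> P \<subseteq> Q \<Longrightarrow> reach Q x y L"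
  unfolding reach_def by blast

lemma reach_mem:
  assumes "reach P x y L" shows "x \<in> P" "y \<in> P"
  using assms unfolding reach_def by (auto simp: image_subset_iff)

lemma dist_le_reach:
  assumes "reach P x y L" shows "dist x y \<le> L"
proof -
  obtain g where "1-lipschitz_on {0..L} g" "g 0 = x" "g L = y" "0 \<le> L"
    using assms unfolding reach_def by blast
  then show ?thesis using lipschitz_onD[of 1 "{0..L}" g 0 L] by (auto simp: dist_real_def)
qed

lemma reach_trans:
  assumes "reach P x y L" "reach P y z M" shows "reach P x z (L + M)"
proof -
  obtain g where g: "1-lipschitz_on {0..L} g" "g ` {0..L} \<subseteq> P" "g 0 = x" "g L = y" "0 \<le> L"
    using assms(1) unfolding reach_def by blast
  obtain h where h: "1-lipschitz_on {0..M} h" "h ` {0..M} \<subseteq> P" "h 0 = y" "h M = z" "0 \<le> M"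
    using assms(2) unfolding reach_def by blast
  have h': "1-lipschitz_on {L..L + M} (\<lambda>t. h (t - L))"
  proof (rule lipschitz_onI)
    fix s t assume "s \<in> {L..L + M}" "t \<in> {L..L + M}"
    then show "dist (h (s - L)) (h (t - L)) \<le> 1 * dist s t"
      using lipschitz_onD[OF h(1), of "s - L" "t - L"] by (auto simp: dist_real_def)
  qed simp
  let ?k = "\<lambda>t. if t \<le> L then g t else h (t - L)"
  have "1-lipschitz_on {0..L + M} ?k"
    using lipschitz_on_concat[OF g(1) h'] g(4) h(3) by simp
  moreover have "?k ` {0..L + M} \<subseteq> P" using g(2) h(2) by (auto simp: image_subset_iff)
  moreover have "?k 0 = x" "?k (L + M) = z" using g h by auto
  ultimately show ?thesis unfolding reach_def using g(5) h(5)
    by (intro conjI exI[of _ ?k] add_nonneg_nonneg)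
qed

lemma reach_commute:
  assumes "reach P x y L" shows "reach P y x L"
proof -
  obtain g where g: "1-lipschitz_on {0..L} g" "g ` {0..L} \<subseteq> P" "g 0 = x" "g L = y" "0 \<le> L"
    using assms(1) unfolding reach_def by blast
  have "1-lipschitz_on {0..L} (\<lambda>t. g (L - t))"
  proof (rule lipschitz_onI)
    fix s t assume "s \<in> {0..L}" "t \<in> {0..L}"
    then show "dist (g (L - s)) (g (L - t)) \<le> 1 * dist s t"
      using lipschitz_onD[OF g(1), of "L - s" "L - t"] by (auto simp: dist_real_def)
  qed simp
  moreover have "(\<lambda>t. g (L - t)) ` {0..L} \<subseteq> P" using g(2) by auto
  ultimately show ?thesis unfolding reach_def using g(3-5)
    by (intro conjI exI[of _ "\<lambda>t. g (L - t)"]) auto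
qed

lemma reach_const: "x \<in> P \<Longrightarrow> 0 \<le> L \<Longrightarrow> reach P x x L"
  unfolding reach_def by (intro conjI exI[of _ "\<lambda>_. x"]) (auto intro: lipschitz_onI)

lemma reach_mono: "reach P x y L \<Longrightarrow> L \<le> M \<Longrightarrow> reach P x y M"
  using reach_trans[of P x y L y "M - L"] reach_const[of y P "M - L"] reach_mem(2) by fastforce

lemma reach_segment:
  assumes "closed_segment x y \<subseteq> P" shows "reach P x y (dist x y)"
proof (cases "x = y")
  case True
  then show ?thesis using assms by (auto intro: reach_const)
next
  case False
  define r where "r = dist x y"
  have "r > 0" using False by (simp add: r_def)
  define g where "g t = x + (t / r) *\<^sub>R (y - x)" for t
  have "1-lipschitz_on {0..r} g"
  proof (rule lipschitz_onI)
    fix s t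
    have "g s - g t = ((s - t) / r) *\<^sub>R (y - x)" by (simp add: g_def algebra_simps diff_divide_distrib)
    then have "dist (g s) (g t) = \<bar>s - t\<bar> / r * dist x y" using \<open>r > 0\<close>
      by (simp only: dist_norm[of "g s"]) (simp add: dist_norm norm_minus_commute)
    then show "dist (g s) (g t) \<le> 1 * dist s t" using \<open>r > 0\<close> by (simp add: r_def dist_real_def)
  qed simp
  moreover have "g ` {0..r} \<subseteq> P"
  proof
    fix z assume "z \<in> g ` {0..r}"
    then obtain t where t: "0 \<le> t" "t \<le> r" "z = g t" by auto
    then have "z \<in> closed_segment x y" unfolding in_segment
      by (intro exI[of _ "t / r"]) (use \<open>r > 0\<close> in \<open>simp add: g_def algebra_simps\<close>)
    then show "z \<in> P" using assms by blast
  qed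
  moreover have "g 0 = x" "g r = y" using \<open>r > 0\<close> by (auto simp: g_def)
  ultimately show ?thesis unfolding reach_def r_def by auto
qed

lemma bdd_below_reach: "bdd_below {L. reach P x y L}"
  by (rule bdd_belowI[of _ 0]) (auto dest: reach_nonneg)

lemma lipdist_le: "reach P x y L \<Longrightarrow> lipdist P x y \<le> L"
  unfolding lipdist_def using cInf_lower[OF _ bdd_below_reach] by auto

lemma lipdist_greatest:
  assumes "reach P x y L0" "\<And>L. reach P x y L \<Longrightarrow> c \<le> L" shows "c \<le> lipdist P x y"
  using assms unfolding lipdist_def by (auto intro!: cInf_greatest)

lemma lipdist_nonneg: "0 \<le> lipdist P x y"
  by (metis lipdist_def lipdist_greatest order_refl reach_nonneg)

lemma lipdist_commute: "lipdist P x y = lipdist P y x"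
proof -
  have "reach P x y = reach P y x" using reach_commute by blast
  then show ?thesis by (simp add: lipdist_def)
qed

lemma reach_lipdist:
  assumes "reach P x y L0" "e > 0" shows "reach P x y (lipdist P x y + e)"
proof -
  have "Inf {L. reach P x y L} < lipdist P x y + e" using assms by (auto simp: lipdist_def)
  then obtain L where "reach P x y L" "L < lipdist P x y + e"
    using cInf_lessD[of "{L. reach P x y L}"] assms(1) by blast
  then show ?thesis using reach_mono by auto
qed

lemma dist_le_lipdist: "reach P x y L \<Longrightarrow> dist x y \<le> lipdist P x y"
  by (rule lipdist_greatest) (auto intro: dist_le_reach)

lemma lipdist_triangle:
  assumes "reach P x y L" "reach P y z M"
  shows "lipdist P x z \<le> lipdist P x y + lipdist P y z"
proof (rule field_le_epsilon)
  fix e :: real assume "e > 0"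
  then have "reach P x z ((lipdist P x y + e/2) + (lipdist P y z + e/2))"
    using assms by (intro reach_trans[where y = y] reach_lipdist[of P x y L] reach_lipdist[of P y z M]) auto
  then show "lipdist P x z \<le> lipdist P x y + lipdist P y z + e" using lipdist_le by fastforce
qed

lemma lipdist_refl: "x \<in> P \<Longrightarrow> lipdist P x x = 0"
  using lipdist_le[OF reach_const[of x P 0]] lipdist_nonneg[of P x x] by simp

lemma Metric_space_lipdist:
  assumes "X \<subseteq> P" and conn: "\<And>x y. \<lbrakk>x \<in> X; y \<in> X\<rbrakk> \<Longrightarrow> \<exists>L. reach P x y L"
  shows "Metric_space X (lipdist P)"
proof
  fix x y assume xy: "x \<in> X" "y \<in> X"
  then obtain L where "reach P x y L" using conn by blast
  then show "(lipdist P x y = 0) = (x = y)"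
    using dist_le_lipdist[of P x y L] lipdist_refl xy assms(1) by auto
next
  fix x y z assume "x \<in> X" "y \<in> X" "z \<in> X"
  then show "lipdist P x z \<le> lipdist P x y + lipdist P y z"
    using conn lipdist_triangle by metis
qed (use lipdist_nonneg lipdist_commute in auto)

lemma lipdist_eq_dist: "closed_segment x y \<subseteq> P \<Longrightarrow> lipdist P x y = dist x y"
  using reach_segment lipdist_le dist_le_lipdist by (metis order_antisym)

text \<open>
  With \<open>p - x = w - u\<close>, \<open>p - y = w + v\<close> and \<open>p - n = w\<close>, the equality case of the triangle inequality
  makes \<open>u\<close> and \<open>v\<close> positively proportional, so that the inner products with \<open>w\<close> cancel.
\<close>

lemma euclidean_stewart:
  fixes p x n y :: "'a::real_inner"
  assumes "dist x y = dist x n + dist n y"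
  shows "(dist p n)\<^sup>2 * (dist x n + dist n y) =
      (dist p x)\<^sup>2 * dist n y + (dist p y)\<^sup>2 * dist x n - dist x n * dist n y * (dist x n + dist n y)"
proof -
  define a b u v w where "a = norm (x - n)" and "b = norm (n - y)" and "u = x - n" and "v = n - y"
    and "w = p - n"
  have uv: "a *\<^sub>R v = b *\<^sub>R u"
    using assms dist_triangle_eq[of x y n] unfolding a_def b_def u_def v_def by simp
  have px: "p - x = w - u" and py: "p - y = w + v" by (auto simp: u_def v_def w_def)
  have 1: "(norm (w - u))\<^sup>2 = (norm w)\<^sup>2 - 2 * (w \<bullet> u) + a\<^sup>2"
    by (simp add: power2_norm_eq_inner a_def u_def[symmetric] inner_diff_left inner_diff_right inner_commute)
  have 2: "(norm (w + v))\<^sup>2 = (norm w)\<^sup>2 + 2 * (w \<bullet> v) + b\<^sup>2"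
    by (simp add: power2_norm_eq_inner b_def v_def[symmetric] inner_add_left inner_add_right inner_commute)
  have "a * (w \<bullet> v) = b * (w \<bullet> u)" using arg_cong[OF uv, of "\<lambda>z. w \<bullet> z"] by simp
  then have "(norm w)\<^sup>2 * (a + b) =
      ((norm w)\<^sup>2 - 2 * (w \<bullet> u) + a\<^sup>2) * b + ((norm w)\<^sup>2 + 2 * (w \<bullet> v) + b\<^sup>2) * a - a * b * (a + b)"
    by (simp add: algebra_simps power2_eq_square)
  then show ?thesis
    unfolding dist_norm px py a_def[symmetric] b_def[symmetric] w_def[symmetric] 1 2 .
qed

lemma connected_one_side:
  assumes "connected K" "closed A" "closed B" "K \<subseteq> A \<union> B" "K \<inter> (A \<inter> B) = {}" "x \<in> K" "x \<in> A"
  shows "K \<subseteq> A"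
  using assms unfolding connected_closed by blast

text \<open>
  A curve in the union between points of \<open>A\<close> can be replaced by one in \<open>A\<close>: follow it until it first
  meets the convex set \<open>A \<inter> B\<close>, then use the straight segment to the place of the last meeting.
\<close>

lemma reach_glue_within:
  assumes "closed A" "closed B" and conv: "convex (A \<inter> B)"
    and "reach (A \<union> B) x y L" and x: "x \<in> A" and y: "y \<in> A"
  shows "reach A x y L"
proof -
  obtain g where g: "1-lipschitz_on {0..L} g" "g ` {0..L} \<subseteq> A \<union> B" "g 0 = x" "g L = y" "0 \<le> L"
    using assms(4) unfolding reach_def by blast
  have cont: "continuous_on {0..L} g" using lipschitz_on_continuous_on[OF g(1)] .
  define T where "T = {0..L} \<inter> g -` (A \<inter> B)"
  have "closed T" unfolding T_def
    using assms(1,2) cont by (intro continuous_closed_preimage) auto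
  moreover have "bounded T" by (rule bounded_subset[of "{0..L}"]) (auto simp: T_def)
  ultimately have "compact T" by (simp add: compact_eq_bounded_closed)
  show ?thesis
  proof (cases "T = {}")
    case True
    have "g ` {0..L} \<subseteq> A"
    proof (rule connected_one_side[OF _ assms(1,2) g(2)])
      show "connected (g ` {0..L})" using cont by (intro connected_continuous_image) auto
      show "g ` {0..L} \<inter> (A \<inter> B) = {}" using True by (auto simp: T_def)
      show "x \<in> g ` {0..L}" using g by force
    qed (rule x)
    then show ?thesis unfolding reach_def using g by blast
  next
    case False
    obtain t1 where t1: "t1 \<in> T" "\<And>t. t \<in> T \<Longrightarrow> t1 \<le> t"
      using compact_attains_inf[OF \<open>compact T\<close> False] by blast
    obtain t2 where t2: "t2 \<in> T" "\<And>t. t \<in> T \<Longrightarrow> t \<le> t2"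
      using compact_attains_sup[OF \<open>compact T\<close> False] by blast
    have t12: "0 \<le> t1" "t1 \<le> t2" "t2 \<le> L" using t1 t2 by (auto simp: T_def)
    have S: "g t1 \<in> A \<inter> B" "g t2 \<in> A \<inter> B" using t1 t2 by (auto simp: T_def)
    have "g ` {0..<t1} \<subseteq> A"
    proof (cases "t1 = 0")
      case False
      show ?thesis
      proof (rule connected_one_side[OF _ assms(1,2)])
        show "connected (g ` {0..<t1})"
          by (rule connected_continuous_image[OF continuous_on_subset[OF cont]]) (use t12 in auto)
        show "g ` {0..<t1} \<subseteq> A \<union> B" using g(2) t12 by (auto simp: image_subset_iff)
        show "g ` {0..<t1} \<inter> (A \<inter> B) = {}" using t1 t12 by (force simp: T_def)
        show "x \<in> g ` {0..<t1}" using g(3) False t12 by force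
      qed (rule x)
    qed auto
    then have "g ` {0..t1} \<subseteq> A" using S by (metis IntD1 atLeastLessThan_iff atLeastAtMost_iff image_subset_iff less_eq_real_def)
    moreover have "1-lipschitz_on {0..t1} g" by (rule lipschitz_on_subset[OF g(1)]) (use t12 in auto)
    ultimately have r1: "reach A x (g t1) t1" using reachI[of 0 t1 g A] t12 g(3) by auto
    have "g ` {t2<..L} \<subseteq> A"
    proof (cases "t2 = L")
      case False
      show ?thesis
      proof (rule connected_one_side[OF _ assms(1,2)])
        show "connected (g ` {t2<..L})"
          by (rule connected_continuous_image[OF continuous_on_subset[OF cont]]) (use t12 in auto)
        show "g ` {t2<..L} \<subseteq> A \<union> B" using g(2) t12 by (auto simp: image_subset_iff)
        show "g ` {t2<..L} \<inter> (A \<inter> B) = {}"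
        proof (rule ccontr)
          assume "\<not> ?thesis"
          then obtain z where "z \<in> g ` {t2<..L}" "z \<in> A \<inter> B" by blast
          then obtain t where t: "t2 < t" "t \<le> L" "g t \<in> A \<inter> B" by auto
          then have "t \<in> T" using t12 by (auto simp: T_def)
          then show False using t2(2) t(1) by fastforce
        qed
        show "y \<in> g ` {t2<..L}" using g(4) False t12 by force
      qed (rule y)
    qed auto
    then have "g ` {t2..L} \<subseteq> A" using S by (metis IntD1 greaterThanAtMost_iff atLeastAtMost_iff image_subset_iff less_eq_real_def)
    moreover have "1-lipschitz_on {t2..L} g" by (rule lipschitz_on_subset[OF g(1)]) (use t12 in auto)
    ultimately have r3: "reach A (g t2) y (L - t2)" using reachI[of t2 L g A] t12 g(4) by auto
    have "closed_segment (g t1) (g t2) \<subseteq> A \<inter> B" using closed_segment_subset[OF S conv] .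
    then have "reach A (g t1) (g t2) (dist (g t1) (g t2))" by (intro reach_segment) blast
    moreover have "dist (g t1) (g t2) \<le> t2 - t1"
      using lipschitz_onD[OF g(1), of t1 t2] t12 by (auto simp: dist_real_def)
    ultimately have "reach A (g t1) (g t2) (t2 - t1)" using reach_mono by blast
    then have "reach A x y (t1 + (t2 - t1) + (L - t2))" using r1 r3 by (intro reach_trans)
    then show ?thesis by simp
  qed
qed

lemma reach_glue_across:
  assumes "closed A" "closed B" "convex (A \<inter> B)" "reach (A \<union> B) a b L" "a \<in> A" "b \<in> B"
  shows "\<exists>s\<in>A \<inter> B. \<exists>L1 L2. L = L1 + L2 \<and> reach A a s L1 \<and> reach B s b L2"
proof -
  obtain g where g: "1-lipschitz_on {0..L} g" "g ` {0..L} \<subseteq> A \<union> B" "g 0 = a" "g L = b" "0 \<le> L"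
    using assms(4) unfolding reach_def by blast
  have cont: "continuous_on {0..L} g" using lipschitz_on_continuous_on[OF g(1)] .
  have "\<exists>t\<in>{0..L}. g t \<in> A \<inter> B"
  proof (rule ccontr)
    assume no: "\<not> ?thesis"
    have "g ` {0..L} \<subseteq> A"
    proof (rule connected_one_side[OF _ assms(1,2) g(2)])
      show "connected (g ` {0..L})" using cont by (intro connected_continuous_image) auto
      show "g ` {0..L} \<inter> (A \<inter> B) = {}" using no by auto
      show "a \<in> g ` {0..L}" using g by force
    qed (rule assms(5))
    then have "b \<in> A" using g(4,5) by force
    then show False using no assms(6) g(4,5) by auto
  qed
  then obtain t where t: "0 \<le> t" "t \<le> L" "g t \<in> A \<inter> B" by auto
  have "reach (A \<union> B) (g 0) (g t) (t - 0)"
    by (rule reachI[OF lipschitz_on_subset[OF g(1)]]) (use g(2) t in \<open>auto simp: image_subset_iff\<close>)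
  then have 1: "reach A a (g t) t"
    using reach_glue_within[OF assms(1,2,3) _ assms(5)] t g(3) by auto
  have "reach (A \<union> B) (g t) (g L) (L - t)"
    by (rule reachI[OF lipschitz_on_subset[OF g(1)]]) (use g(2) t in \<open>auto simp: image_subset_iff\<close>)
  then have "reach (B \<union> A) (g t) b (L - t)" using g(4) by (simp add: Un_commute)
  then have "reach B (g t) b (L - t)"
    using reach_glue_within[OF assms(2,1), of "g t" b] assms(3,6) t by (auto simp: Int_commute)
  then show ?thesis using 1 t by (intro bexI[of _ "g t"] exI[of _ t] exI[of _ "L - t"]) auto
qed

text \<open>
  With \<open>lipdist\<close> such a region is a geodesic space with thin triangles; see \<open>geodesic_triangle_thin\<close>.
\<close>

definition hadamard_region :: "complex set \<Rightarrow> bool" where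
  "hadamard_region P \<longleftrightarrow> closed P \<and> lip_connected P \<and>
     divisible_on P (lipdist P) \<and> stewart_on P (lipdist P)"

lemma divisible_on_cong:
  assumes "divisible_on X d" "\<And>x y. x \<in> X \<Longrightarrow> y \<in> X \<Longrightarrow> d x y = d' x y"
  shows "divisible_on X d'"
  unfolding divisible_on_def
proof (intro ballI)
  fix x y and t :: real assume m: "x \<in> X" "y \<in> X" "t \<in> {0..1}"
  then obtain m where "m \<in> X" "d x m = t * d x y" "d m y = (1 - t) * d x y"
    using assms(1) unfolding divisible_on_def by blast
  then show "\<exists>m\<in>X. d' x m = t * d' x y \<and> d' m y = (1 - t) * d' x y"
    using m assms(2) by (intro bexI[of _ m]) auto
qed

lemma stewart_on_cong:
  assumes "stewart_on X d" "\<And>x y. x \<in> X \<Longrightarrow> y \<in> X \<Longrightarrow> d x y = d' x y"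
  shows "stewart_on X d'"
  using assms(1) unfolding stewart_on_def lies_between_def stewart_ineq_def by (simp add: assms(2))

lemma divisible_on_convex:
  assumes "convex P" shows "divisible_on P (dist :: complex \<Rightarrow> _)"
  unfolding divisible_on_def
proof (intro ballI)
  fix x y and t :: real assume a: "x \<in> P" "y \<in> P" "t \<in> {0..1}"
  let ?m = "(1 - t) *\<^sub>R x + t *\<^sub>R y"
  have "?m \<in> P" using assms a by (auto simp: convex_def)
  moreover have "x - ?m = t *\<^sub>R (x - y)" "?m - y = (1 - t) *\<^sub>R (x - y)" by (auto simp: algebra_simps)
  then have "dist x ?m = t * dist x y" "dist ?m y = (1 - t) * dist x y"
    using a(3) by (auto simp: dist_norm)
  ultimately show "\<exists>m\<in>P. dist x m = t * dist x y \<and> dist m y = (1 - t) * dist x y" by blast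
qed

lemma hadamard_region_convex:
  assumes "closed P" "convex P" shows "hadamard_region P"
proof -
  have seg: "closed_segment x y \<subseteq> P" if "x \<in> P" "y \<in> P" for x y
    using assms(2) that by (simp add: closed_segment_subset)
  have eq: "dist x y = lipdist P x y" if "x \<in> P" "y \<in> P" for x y
    using lipdist_eq_dist[OF seg[OF that]] by simp
  have "stewart_on P dist"
    unfolding stewart_on_def lies_between_def stewart_ineq_def
    by (intro ballI impI eq_refl euclidean_stewart)
  then have "stewart_on P (lipdist P)" by (rule stewart_on_cong) (use eq in auto)
  moreover have "divisible_on P (lipdist P)"
    by (rule divisible_on_cong[OF divisible_on_convex[OF assms(2)]]) (use eq in auto)
  moreover have "lip_connected P" unfolding lip_connected_def using reach_segment[OF seg] by (intro ballI exI)
  ultimately show ?thesis using assms(1) by (simp add: hadamard_region_def)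
qed

lemma lipdist_glue_within:
  assumes "closed A" "closed B" "convex (A \<inter> B)" "x \<in> A" "y \<in> A"
  shows "lipdist (A \<union> B) x y = lipdist A x y"
proof -
  have "reach (A \<union> B) x y = reach A x y"
    using reach_glue_within[OF assms(1-3) _ assms(4,5)] reach_subset[of A x y _ "A \<union> B"] by blast
  then show ?thesis by (simp add: lipdist_def)
qed

text \<open>
  By \<open>lipdist_glue_within\<close> the distances of \<open>A\<close> and of \<open>B\<close> are those of the union. The best crossing
  point exists because the common part is compact and distances are continuous on it.
\<close>

theorem hadamard_region_glue:
  assumes A: "hadamard_region A" and B: "hadamard_region B"
    and S: "convex (A \<inter> B)" "compact (A \<inter> B)" "A \<inter> B \<noteq> {}"
  shows "hadamard_region (A \<union> B)"
proof -
  let ?d = "lipdist (A \<union> B)"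
  have cl: "closed A" "closed B" using A B by (auto simp: hadamard_region_def)
  have eqA: "lipdist A x y = ?d x y" if "x \<in> A" "y \<in> A" for x y
    using lipdist_glue_within[OF cl S(1) that] by simp
  have eqB: "lipdist B x y = ?d x y" if "x \<in> B" "y \<in> B" for x y
    using lipdist_glue_within[OF cl(2,1) _ that] S(1) by (simp add: Un_commute Int_commute)
  have segS: "closed_segment x y \<subseteq> A \<inter> B" if "x \<in> A \<inter> B" "y \<in> A \<inter> B" for x y
    using closed_segment_subset[OF that S(1)] .
  have eqS: "?d x y = dist x y" if "x \<in> A \<inter> B" "y \<in> A \<inter> B" for x y
    using lipdist_eq_dist[of x y "A \<union> B"] segS[OF that] by blast
  have conA: "\<exists>L. reach (A \<union> B) x y L" if "x \<in> A" "y \<in> A" for x y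
    using A that reach_subset[of A x y _ "A \<union> B"] unfolding hadamard_region_def lip_connected_def by blast
  have conB: "\<exists>L. reach (A \<union> B) x y L" if "x \<in> B" "y \<in> B" for x y
    using B that reach_subset[of B x y _ "A \<union> B"] unfolding hadamard_region_def lip_connected_def by blast
  obtain s0 where s0: "s0 \<in> A" "s0 \<in> B" using S(3) by blast
  have con: "lip_connected (A \<union> B)"
    unfolding lip_connected_def
  proof (intro ballI)
    fix x y assume "x \<in> A \<union> B" "y \<in> A \<union> B"
    then obtain L M where "reach (A \<union> B) x s0 L" "reach (A \<union> B) s0 y M"
      using conA conB s0 by (metis UnE)
    then show "\<exists>L. reach (A \<union> B) x y L" using reach_trans by blast
  qed
  interpret Z: Metric_space "A \<union> B" ?d using Metric_space_lipdist[OF order_refl] con unfolding lip_connected_def by blast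
  interpret gluing A B ?d
  proof (rule gluing.intro)
    show "Metric_space (A \<union> B) ?d" ..
    show "stewart_on A ?d" "divisible_on A ?d"
      using A stewart_on_cong divisible_on_cong eqA unfolding hadamard_region_def by metis+
    show "stewart_on B ?d" "divisible_on B ?d"
      using B stewart_on_cong divisible_on_cong eqB unfolding hadamard_region_def by metis+
    show "divisible_on (A \<inter> B) ?d"
      by (rule divisible_on_cong[OF divisible_on_convex[OF S(1)]]) (use eqS in auto)
  next
    fix a b assume ab: "a \<in> A" "b \<in> B"
    have "1-lipschitz_on (A \<inter> B) (\<lambda>s. ?d a s)" "1-lipschitz_on (A \<inter> B) (\<lambda>s. ?d s b)"
    proof -
      have *: "\<bar>?d c s - ?d c s'\<bar> \<le> dist s s'" if "c \<in> A \<union> B" "s \<in> A \<inter> B" "s' \<in> A \<inter> B" for c s s'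
        using Z.triangle[of c s s'] Z.triangle[of c s' s] eqS[OF that(2,3)] Z.commute[of s s'] that
        by auto
      show "1-lipschitz_on (A \<inter> B) (\<lambda>s. ?d a s)"
        by (rule lipschitz_onI) (use * ab in \<open>auto simp: dist_real_def\<close>)
      show "1-lipschitz_on (A \<inter> B) (\<lambda>s. ?d s b)"
        by (rule lipschitz_onI) (use *[of b] ab in \<open>auto simp: dist_real_def Z.commute[of _ b]\<close>)
    qed
    then have "continuous_on (A \<inter> B) (\<lambda>s. ?d a s + ?d s b)"
      by (intro continuous_on_add lipschitz_on_continuous_on)
    then obtain s where s: "s \<in> A \<inter> B" "\<And>s'. s' \<in> A \<inter> B \<Longrightarrow> ?d a s + ?d s b \<le> ?d a s' + ?d s' b"
      using continuous_attains_inf[OF S(2,3)] by blast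
    have "?d a s + ?d s b \<le> ?d a b"
    proof -
      obtain L0 where "reach (A \<union> B) a b L0" using con ab unfolding lip_connected_def by blast
      then show ?thesis
      proof (rule lipdist_greatest)
        fix L assume "reach (A \<union> B) a b L"
        then obtain s' L1 L2 where s': "s' \<in> A \<inter> B" "L = L1 + L2" "reach A a s' L1" "reach B s' b L2"
          using reach_glue_across[OF cl S(1) _ ab] by blast
        have "?d a s' \<le> L1" using s'(3) by (intro lipdist_le) (auto intro: reach_subset)
        moreover have "?d s' b \<le> L2" using s'(4) by (intro lipdist_le) (auto intro: reach_subset)
        ultimately show "?d a s + ?d s b \<le> L" using s(2)[OF s'(1)] s'(2) by linarith
      qed
    qed
    moreover have "?d a b \<le> ?d a s + ?d s b" using Z.triangle ab s(1) by blast
    ultimately have "lies_between ?d a s b" by (simp add: lies_between_def)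
    then show "\<exists>s\<in>A \<inter> B. lies_between ?d a s b" using s(1) by blast
  qed
  show ?thesis
    using closed_Un[OF cl] con glued_stewart glued_divisible by (simp add: hadamard_region_def)
qed

section \<open>Unions of grid squares\<close>

definition grid_cell :: "real \<Rightarrow> int \<times> int \<Rightarrow> complex set" where
  "grid_cell \<delta> c = {z. of_int (fst c) * \<delta> \<le> Re z \<and> Re z \<le> of_int (fst c + 1) * \<delta> \<and>
                    of_int (snd c) * \<delta> \<le> Im z \<and> Im z \<le> of_int (snd c + 1) * \<delta>}"

definition grid_cells :: "real \<Rightarrow> (int \<times> int) set \<Rightarrow> complex set" where
  "grid_cells \<delta> T = (\<Union>c\<in>T. grid_cell \<delta> c)"

lemma rectangle_eq_cbox: "{z. a \<le> Re z \<and> Re z \<le> b \<and> c \<le> Im z \<and> Im z \<le> d} = cbox (Complex a c) (Complex b d)"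
  by (auto simp: in_cbox_complex_iff)

lemma compact_rectangle: "compact {z. a \<le> Re z \<and> Re z \<le> b \<and> c \<le> Im z \<and> Im z \<le> d}"
  and convex_rectangle: "convex {z. a \<le> Re z \<and> Re z \<le> b \<and> c \<le> Im z \<and> Im z \<le> d}"
  unfolding rectangle_eq_cbox by (rule compact_cbox, rule convex_box)

lemma compact_grid_cell: "compact (grid_cell \<delta> c)" and convex_grid_cell: "convex (grid_cell \<delta> c)"
  unfolding grid_cell_def by (rule compact_rectangle, rule convex_rectangle)

lemma grid_cell_nonempty: "\<delta> > 0 \<Longrightarrow> grid_cell \<delta> c \<noteq> {}"
proof -
  assume "\<delta> > 0"
  then have "Complex (of_int (fst c) * \<delta>) (of_int (snd c) * \<delta>) \<in> grid_cell \<delta> c"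
    by (simp add: grid_cell_def)
  then show ?thesis by blast
qed

lemma compact_grid_cells: "finite T \<Longrightarrow> compact (grid_cells \<delta> T)"
  unfolding grid_cells_def by (intro compact_UN compact_grid_cell)

lemma convex_horizontal_connected:
  assumes "connected S" "\<And>z. z \<in> S \<Longrightarrow> Im z = c" shows "convex S"
proof -
  have "connected (Re ` S)" using assms(1) by (intro connected_continuous_image continuous_intros)
  then have "convex (Re ` S)" by (simp add: is_interval_connected_1 is_interval_convex_1[symmetric])
  then have "convex ((\<lambda>x. Complex x c) ` (Re ` S))"
    unfolding convex_def
  proof (intro ballI allI impI)
    fix x y u v assume *: "\<forall>x\<in>Re ` S. \<forall>y\<in>Re ` S. \<forall>u\<ge>0. \<forall>v\<ge>0. u + v = 1 \<longrightarrow> u *\<^sub>R x + v *\<^sub>R y \<in> Re ` S"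
      and xy: "x \<in> (\<lambda>x. Complex x c) ` Re ` S" "y \<in> (\<lambda>x. Complex x c) ` Re ` S"
      and uv: "(0::real) \<le> u" "0 \<le> v" "u + v = 1"
    obtain x' y' where x': "x' \<in> Re ` S" "x = Complex x' c" and y': "y' \<in> Re ` S" "y = Complex y' c"
      using xy by blast
    have "u *\<^sub>R x' + v *\<^sub>R y' \<in> Re ` S" using * x' y' uv by blast
    moreover have "u * c + v * c = c" using uv(3) by (metis distrib_right mult_1)
    then have "u *\<^sub>R x + v *\<^sub>R y = Complex (u *\<^sub>R x' + v *\<^sub>R y') c"
      by (simp add: x' y' complex_eq_iff)
    ultimately show "u *\<^sub>R x + v *\<^sub>R y \<in> (\<lambda>x. Complex x c) ` Re ` S" by auto
  qed
  moreover have "(\<lambda>x. Complex x c) ` (Re ` S) = S"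
    using assms(2) by (force simp: image_image complex_eq_iff intro!: image_eqI)
  ultimately show ?thesis by simp
qed

lemma component_grid_cells:
  assumes "\<delta> > 0" "K \<in> components (grid_cells \<delta> T)"
  shows "K = grid_cells \<delta> {c \<in> T. grid_cell \<delta> c \<subseteq> K}"
proof
  show "K \<subseteq> grid_cells \<delta> {c \<in> T. grid_cell \<delta> c \<subseteq> K}"
  proof
    fix z assume z: "z \<in> K"
    then obtain c where c: "c \<in> T" "z \<in> grid_cell \<delta> c"
      using in_components_subset[OF assms(2)] by (auto simp: grid_cells_def)
    have "grid_cell \<delta> c \<subseteq> K"
    proof (rule components_maximal[OF assms(2)])
      show "connected (grid_cell \<delta> c)" by (simp add: convex_connected convex_grid_cell)
      show "grid_cell \<delta> c \<subseteq> grid_cells \<delta> T" using c by (auto simp: grid_cells_def)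
      show "K \<inter> grid_cell \<delta> c \<noteq> {}" using z c by blast
    qed
    then show "z \<in> grid_cells \<delta> {c \<in> T. grid_cell \<delta> c \<subseteq> K}" using c unfolding grid_cells_def by blast
  qed
qed (auto simp: grid_cells_def)

text \<open>
  The set \<open>Tr\<close> is the leftmost maximal run of consecutive squares in the top row. Other squares of
  this row do not touch it, since at least one square is missing in between, so that the run meets
  the remaining squares only along its lower side.
\<close>

lemma grid_cells_top_run:
  assumes "\<delta> > 0" "finite T" "T \<noteq> {}"
  obtains Tr a b k where "Tr \<subseteq> T" "Tr \<noteq> {}"
    "grid_cells \<delta> Tr = {z. of_int a * \<delta> \<le> Re z \<and> Re z \<le> of_int (b + 1) * \<delta> \<and>
                        of_int k * \<delta> \<le> Im z \<and> Im z \<le> of_int (k + 1) * \<delta>}"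
    "\<forall>z \<in> grid_cells \<delta> Tr \<inter> grid_cells \<delta> (T - Tr). Im z = of_int k * \<delta>"
    "\<forall>z \<in> grid_cells \<delta> T. Im z \<le> of_int (k + 1) * \<delta>"
proof -
  define k where "k = Max (snd ` T)"
  have kmax: "snd c \<le> k" if "c \<in> T" for c using that assms(2) by (simp add: k_def)
  have "k \<in> snd ` T" unfolding k_def using assms(2,3) by (intro Max_in) auto
  define Row where "Row = {i. (i, k) \<in> T}"
  have "Row \<subseteq> fst ` T" by (force simp: Row_def)
  then have finR: "finite Row" using assms(2) finite_surj by blast
  have "Row \<noteq> {}" using \<open>k \<in> snd ` T\<close> by (auto simp: Row_def)
  define a where "a = Min Row"
  have aR: "a \<in> Row" and amin: "\<And>i. i \<in> Row \<Longrightarrow> a \<le> i"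
    using finR \<open>Row \<noteq> {}\<close> by (auto simp: a_def)
  define B where "B = {i \<in> Row. {a..i} \<subseteq> Row}"
  have finB: "finite B" using finR by (simp add: B_def)
  have "a \<in> B" using aR by (simp add: B_def)
  define b where "b = Max B"
  have "b \<in> B" unfolding b_def using finB \<open>a \<in> B\<close> by (intro Max_in) auto
  then have run: "{a..b} \<subseteq> Row" and "a \<le> b" using amin by (auto simp: B_def)
  have stop: "b + 1 \<notin> Row"
  proof
    assume "b + 1 \<in> Row"
    moreover have "{a..b + 1} = insert (b + 1) {a..b}" using \<open>a \<le> b\<close> by auto
    ultimately have "b + 1 \<in> B" using run by (simp add: B_def)
    then have "b + 1 \<le> b" unfolding b_def using finB by (intro Max_ge)
    then show False by simp
  qed
  define Tr where "Tr = {a..b} \<times> {k}"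
  show ?thesis
  proof
    show "Tr \<subseteq> T" using run by (auto simp: Tr_def Row_def)
    show "Tr \<noteq> {}" using \<open>a \<le> b\<close> by (auto simp: Tr_def)
    show eq: "grid_cells \<delta> Tr = {z. of_int a * \<delta> \<le> Re z \<and> Re z \<le> of_int (b + 1) * \<delta> \<and>
                        of_int k * \<delta> \<le> Im z \<and> Im z \<le> of_int (k + 1) * \<delta>}" (is "_ = ?R")
    proof
      show "grid_cells \<delta> Tr \<subseteq> ?R"
      proof
        fix z assume "z \<in> grid_cells \<delta> Tr"
        then obtain i where i: "a \<le> i" "i \<le> b" and z: "z \<in> grid_cell \<delta> (i, k)"
          by (auto simp: grid_cells_def Tr_def)
        have "of_int a * \<delta> \<le> of_int i * \<delta>" "of_int (i + 1) * \<delta> \<le> of_int (b + 1) * \<delta>"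
          using i assms(1) by (intro mult_right_mono; simp)+
        then show "z \<in> ?R" using z by (auto simp: grid_cell_def)
      qed
      show "?R \<subseteq> grid_cells \<delta> Tr"
      proof
        fix z assume z: "z \<in> ?R"
        define i where "i = min b \<lfloor>Re z / \<delta>\<rfloor>"
        have ai: "a \<le> \<lfloor>Re z / \<delta>\<rfloor>" using z assms(1) by (simp add: le_floor_iff pos_le_divide_eq)
        have "of_int i \<le> Re z / \<delta>" unfolding i_def by linarith
        then have 1: "of_int i * \<delta> \<le> Re z" using assms(1) by (simp add: pos_le_divide_eq)
        have 2: "Re z \<le> of_int (i + 1) * \<delta>"
        proof (cases "b \<le> \<lfloor>Re z / \<delta>\<rfloor>")
          case True
          then show ?thesis using z by (simp add: i_def min_def)
        next
          case False
          then have "i = \<lfloor>Re z / \<delta>\<rfloor>" by (simp add: i_def)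
          then have "Re z / \<delta> \<le> of_int (i + 1)" by linarith
          then show ?thesis using assms(1) by (simp add: pos_divide_le_eq)
        qed
        have "(i, k) \<in> Tr" using ai \<open>a \<le> b\<close> by (auto simp: Tr_def i_def)
        moreover have "z \<in> grid_cell \<delta> (i, k)" using 1 2 z by (simp add: grid_cell_def)
        ultimately show "z \<in> grid_cells \<delta> Tr" by (auto simp: grid_cells_def)
      qed
    qed
    show "\<forall>z \<in> grid_cells \<delta> Tr \<inter> grid_cells \<delta> (T - Tr). Im z = of_int k * \<delta>"
    proof
      fix z assume "z \<in> grid_cells \<delta> Tr \<inter> grid_cells \<delta> (T - Tr)"
      then have zR': "z \<in> grid_cells \<delta> Tr" and zT: "z \<in> grid_cells \<delta> (T - Tr)" by auto
      have zR: "Re z \<le> of_int (b + 1) * \<delta>" "of_int k * \<delta> \<le> Im z" using zR' unfolding eq by auto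
      obtain i j where c: "(i, j) \<in> T" "(i, j) \<notin> Tr" "z \<in> grid_cell \<delta> (i, j)"
        using zT by (auto simp: grid_cells_def)
      show "Im z = of_int k * \<delta>"
      proof (cases "j = k")
        case True
        then have "i \<in> Row" "i \<notin> {a..b}" using c by (auto simp: Row_def Tr_def)
        then have "i > b" using amin by force
        moreover have "i \<noteq> b + 1" using stop \<open>i \<in> Row\<close> by auto
        ultimately have "b + 1 < i" by simp
        then have "of_int (b + 1) * \<delta> < of_int i * \<delta>" using assms(1) by (simp only: of_int_less_iff mult_less_cancel_right_pos)
        then show ?thesis using c(3) zR by (simp add: grid_cell_def)
      next
        case False
        then have "j + 1 \<le> k" using kmax[OF c(1)] by simp
        then have "of_int (j + 1) * \<delta> \<le> of_int k * \<delta>" using assms(1) by (simp only: of_int_le_iff mult_le_cancel_right_pos)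
        then show ?thesis using c(3) zR by (simp add: grid_cell_def)
      qed
    qed
    show "\<forall>z \<in> grid_cells \<delta> T. Im z \<le> of_int (k + 1) * \<delta>"
    proof
      fix z assume zT: "z \<in> grid_cells \<delta> T"
      obtain c where c: "c \<in> T" "z \<in> grid_cell \<delta> c" using zT by (auto simp: grid_cells_def)
      have "of_int (snd c + 1) * \<delta> \<le> of_int (k + 1) * \<delta>"
        using kmax[OF c(1)] assms(1) by (intro mult_right_mono) auto
      then show "Im z \<le> of_int (k + 1) * \<delta>" using c(2) by (simp add: grid_cell_def)
    qed
  qed
qed

lemma grid_cells_Un: "grid_cells \<delta> (S \<union> T) = grid_cells \<delta> S \<union> grid_cells \<delta> T"
  by (auto simp: grid_cells_def)

text \<open>
  Induction on the number of squares. Let \<open>R\<close> be a run of squares in the top row and \<open>P'\<close> the union of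
  the others. The complement of \<open>P'\<close> is connected, since vertical rays that start in \<open>R\<close> outside \<open>P'\<close> avoid \<open>P'\<close>;
  therefore the components of \<open>P'\<close> have connected complements, too, and are covered by the
  induction hypothesis. Each of them meets \<open>R\<close> in a connected set by Janiszewski's theorem, applied to the
  component and the union of all other pieces. A connected subset of a horizontal line is convex,
  so the components can be glued to \<open>R\<close> one after the other.
\<close>

theorem hadamard_region_grid_cells:
  assumes "\<delta> > 0" "finite T" "T \<noteq> {}" "connected (grid_cells \<delta> T)" "connected (- grid_cells \<delta> T)"
  shows "hadamard_region (grid_cells \<delta> T)"
  using assms(2-5)
proof (induction "card T" arbitrary: T rule: less_induct)
  case less
  obtain Tr a b k where Tr: "Tr \<subseteq> T" "Tr \<noteq> {}"
    and R: "grid_cells \<delta> Tr = {z. of_int a * \<delta> \<le> Re z \<and> Re z \<le> of_int (b + 1) * \<delta> \<and>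
                        of_int k * \<delta> \<le> Im z \<and> Im z \<le> of_int (k + 1) * \<delta>}"
    and base: "\<forall>z \<in> grid_cells \<delta> Tr \<inter> grid_cells \<delta> (T - Tr). Im z = of_int k * \<delta>"
    and top: "\<forall>z \<in> grid_cells \<delta> T. Im z \<le> of_int (k + 1) * \<delta>"
    by (rule grid_cells_top_run[OF assms(1) less.prems(1,2)])
  define P R P' where "P = grid_cells \<delta> T" and "R = grid_cells \<delta> Tr" and "P' = grid_cells \<delta> (T - Tr)"
  have PR: "P = R \<union> P'"
    using Tr(1) grid_cells_Un[of \<delta> Tr "T - Tr"] by (simp add: P_def R_def P'_def Un_absorb1)
  have compR: "compact R" and convR: "convex R"
    unfolding R_def R by (rule compact_rectangle, rule convex_rectangle)
  have compP: "compact P" and compP': "compact P'"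
    unfolding P_def P'_def using less.prems(1) by (auto intro: compact_grid_cells)
  have neR: "R \<noteq> {}"
    using Tr(2) grid_cell_nonempty[OF assms(1)] by (auto simp: R_def grid_cells_def)
  have conR: "connected R" using convR by (rule convex_connected)
  have haR: "hadamard_region R" using hadamard_region_convex[OF compact_imp_closed[OF compR] convR] .
  \<comment> \<open>Points of \<open>R\<close> outside \<open>P'\<close> escape upwards: their vertical rays \<open>V z\<close> reach \<open>- P\<close> without meeting \<open>P'\<close>.\<close>
  have "connected (- P')"
  proof -
    define V where "V z = {w. Re w = Re z \<and> Im z \<le> Im w}" for z :: complex
    have conP: "connected (- P)" using less.prems(4) by (simp add: P_def)
    have V1: "V z \<subseteq> - P'" if "z \<in> R - P'" for z
    proof
      fix w assume w: "w \<in> V z"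
      show "w \<in> - P'"
      proof
        assume wP': "w \<in> P'"
        then have "Im w \<le> of_int (k + 1) * \<delta>" using top PR P_def by blast
        then have "w \<in> R" using w that unfolding V_def R_def R by auto
        then have "Im w = of_int k * \<delta>" using base wP' by (simp add: R_def P'_def)
        then have "w = z" using w that unfolding V_def R_def R by (auto simp: complex_eq_iff)
        then show False using that wP' by simp
      qed
    qed
    have V2: "- P \<inter> V z \<noteq> {}" for z
    proof -
      let ?w = "Complex (Re z) (max (Im z) (of_int (k + 1) * \<delta> + 1))"
      have "?w \<notin> P"
      proof
        assume "?w \<in> P"
        then have "Im ?w \<le> of_int (k + 1) * \<delta>" using top by (simp only: P_def)
        then show False by simp
      qed
      then show ?thesis by (auto simp: V_def)
    qed
    have V3: "connected (V z)" for z
    proof (rule convex_connected)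
      have "V z = {w. Re w \<le> Re z} \<inter> {w. Re w \<ge> Re z} \<inter> {w. Im w \<ge> Im z}" by (auto simp: V_def)
      then show "convex (V z)"
        by (simp add: convex_Int convex_halfspace_Im_ge convex_halfspace_Re_le convex_halfspace_Re_ge)
    qed
    have "connected (\<Union>(insert (- P) ((\<lambda>z. - P \<union> V z) ` (R - P'))))"
    proof (rule connected_Union)
      fix s assume "s \<in> insert (- P) ((\<lambda>z. - P \<union> V z) ` (R - P'))"
      then show "connected s" using conP V2 V3 by (auto intro!: connected_Un)
    next
      have "- P \<noteq> {}" using V2 by blast
      then show "\<Inter>(insert (- P) ((\<lambda>z. - P \<union> V z) ` (R - P'))) \<noteq> {}" by blast
    qed
    moreover have "\<Union>(insert (- P) ((\<lambda>z. - P \<union> V z) ` (R - P'))) = - P'"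
    proof
      show "\<Union>(insert (- P) ((\<lambda>z. - P \<union> V z) ` (R - P'))) \<subseteq> - P'" using V1 PR by blast
      have "z \<in> V z" for z by (simp add: V_def)
      then show "- P' \<subseteq> \<Union>(insert (- P) ((\<lambda>z. - P \<union> V z) ` (R - P')))" using PR by blast
    qed
    ultimately show ?thesis by simp
  qed
  have comp: "hadamard_region K \<and> compact K \<and> connected K \<and> K \<noteq> {} \<and> K \<subseteq> P'" if K: "K \<in> components P'" for K
  proof -
    define U where "U = {c \<in> T - Tr. grid_cell \<delta> c \<subseteq> K}"
    have KU: "K = grid_cells \<delta> U"
      using component_grid_cells[OF assms(1)] K unfolding P'_def U_def by blast
    have "U \<subset> T" using Tr by (auto simp: U_def)
    then have "card U < card T" "finite U" using less.prems(1) psubset_card_mono finite_subset by (auto simp: psubset_eq)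
    have "K \<noteq> {}" using in_components_nonempty[OF K] .
    then have "U \<noteq> {}" using KU by (auto simp: grid_cells_def)
    have conK: "connected K" using in_components_connected[OF K] .
    have "connected (- K)"
      using component_complement_connected[OF \<open>connected (- P')\<close>] K by simp
    then have "hadamard_region K"
      using less.hyps[OF \<open>card U < card T\<close> \<open>finite U\<close> \<open>U \<noteq> {}\<close>] conK KU by simp
    then show ?thesis
      using conK \<open>K \<noteq> {}\<close> compact_grid_cells[OF \<open>finite U\<close>] KU in_components_subset[OF K] by simp
  qed
  have "components P' \<subseteq> grid_cells \<delta> ` Pow (T - Tr)"
    using component_grid_cells[OF assms(1), of _ "T - Tr"] unfolding P'_def by blast
  then have fincomp: "finite (components P')" using less.prems(1) finite_surj by (metis finite_Diff finite_Pow_iff)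
  have disj: "K \<inter> \<Union>D = {}" if "K \<in> components P'" "D \<subseteq> components P'" "K \<notin> D" for K D
    using that components_nonoverlap[of K P'] by blast
  have split: "P = K \<union> (R \<union> \<Union>(components P' - {K}))" if "K \<in> components P'" for K
    using PR that Union_components[of P'] by blast
  have compD: "compact (R \<union> \<Union>D)" if "D \<subseteq> components P'" for D
    using compR comp fincomp that by (intro compact_Un compact_Union) (auto intro: finite_subset)
  have meets: "K \<inter> R \<noteq> {}" if K: "K \<in> components P'" for K
  proof
    assume no: "K \<inter> R = {}"
    let ?Q = "R \<union> \<Union>(components P' - {K})"
    have "K \<inter> ?Q = {}" using no disj[OF K, of "components P' - {K}"] by blast
    moreover have "closed K" "closed ?Q"
      using comp[OF K] compD[of "components P' - {K}"] compact_imp_closed by blast+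
    moreover have "K \<inter> P \<noteq> {}" "?Q \<inter> P \<noteq> {}" using split[OF K] comp[OF K] neR by auto
    moreover have "P \<subseteq> K \<union> ?Q" using split[OF K] by simp
    moreover have "connected P" using less.prems(3) by (simp add: P_def)
    ultimately show False
      using connected_closedD[of P K ?Q] by blast
  qed
  have conD: "connected (R \<union> \<Union>D)" if "D \<subseteq> components P'" for D
  proof -
    have "connected (\<Union>(insert R ((\<lambda>K. R \<union> K) ` D)))"
    proof (rule connected_Union)
      fix s assume "s \<in> insert R ((\<lambda>K. R \<union> K) ` D)"
      then show "connected s" using conR comp meets that by (auto intro!: connected_Un simp: Int_commute subset_iff)
    qed (use neR in blast)
    moreover have "\<Union>(insert R ((\<lambda>K. R \<union> K) ` D)) = R \<union> \<Union>D" by blast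
    ultimately show ?thesis by simp
  qed
  have convRK: "convex (R \<inter> K)" if K: "K \<in> components P'" for K
  proof (rule convex_horizontal_connected)
    let ?Q = "R \<union> \<Union>(components P' - {K})"
    have "connected (?Q \<inter> K)"
    proof (rule Janiszewski_dual)
      show "connected (- (?Q \<union> K))"
        using split[OF K] less.prems(4) by (simp add: P_def[symmetric] Un_commute)
    qed (use compD conD comp[OF K] in auto)
    moreover have "?Q \<inter> K = R \<inter> K" using disj[OF K, of "components P' - {K}"] by blast
    ultimately show "connected (R \<inter> K)" by simp
    fix z assume "z \<in> R \<inter> K"
    then show "Im z = of_int k * \<delta>" using base comp[OF K] by (auto simp: R_def P'_def)
  qed
  have "hadamard_region (R \<union> \<Union>D)" if "finite D" "D \<subseteq> components P'" for D
    using that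
  proof (induction D rule: finite_induct)
    case empty
    then show ?case using haR by simp
  next
    case (insert K D)
    then have K: "K \<in> components P'" and D: "D \<subseteq> components P'" by auto
    have eq: "(R \<union> \<Union>D) \<inter> K = R \<inter> K" using disj[OF K D insert.hyps(2)] by blast
    have "hadamard_region ((R \<union> \<Union>D) \<union> K)"
    proof (rule hadamard_region_glue)
      show "hadamard_region (R \<union> \<Union>D)" using insert.IH D by blast
      show "hadamard_region K" using comp[OF K] by simp
    qed (use eq convRK[OF K] meets[OF K] comp[OF K] compR in \<open>auto simp: compact_Int\<close>)
    moreover have "(R \<union> \<Union>D) \<union> K = R \<union> \<Union>(insert K D)" by blast
    ultimately show ?case by simp
  qed
  from this[OF fincomp order_refl] show ?case using PR Union_components[of P'] by (simp add: P_def)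
qed

section \<open>Approximation from outside\<close>

definition nearby_cells :: "complex set \<Rightarrow> real \<Rightarrow> (int \<times> int) set" where
  "nearby_cells J \<delta> = {c. \<exists>z\<in>J. \<exists>w\<in>grid_cell \<delta> c. dist z w \<le> \<delta>}"

abbreviation nearby_region :: "complex set \<Rightarrow> real \<Rightarrow> complex set" where
  "nearby_region J \<delta> \<equiv> grid_cells \<delta> (nearby_cells J \<delta>)"

text \<open>
  The squares near \<open>J\<close> may enclose holes; these are filled.
\<close>

definition filled_region :: "complex set \<Rightarrow> real \<Rightarrow> complex set" where
  "filled_region J \<delta> = - outside (nearby_region J \<delta>)"

lemma grid_cell_eq_cbox:
  "grid_cell \<delta> c = cbox (Complex (of_int (fst c) * \<delta>) (of_int (snd c) * \<delta>))
                       (Complex (of_int (fst c + 1) * \<delta>) (of_int (snd c + 1) * \<delta>))"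
  by (auto simp: grid_cell_def in_cbox_complex_iff)

lemma mem_grid_cell_floor:
  assumes "\<delta> > 0" shows "z \<in> grid_cell \<delta> (\<lfloor>Re z / \<delta>\<rfloor>, \<lfloor>Im z / \<delta>\<rfloor>)"
proof -
  have "of_int \<lfloor>x / \<delta>\<rfloor> * \<delta> \<le> x \<and> x \<le> of_int (\<lfloor>x / \<delta>\<rfloor> + 1) * \<delta>" for x :: real
  proof -
    have "of_int \<lfloor>x / \<delta>\<rfloor> \<le> x / \<delta>" "x / \<delta> \<le> of_int (\<lfloor>x / \<delta>\<rfloor> + 1)" by linarith+
    then show ?thesis by (simp only: pos_le_divide_eq[OF assms] pos_divide_le_eq[OF assms])
  qed
  then show ?thesis by (simp add: grid_cell_def)
qed

lemma dist_grid_cell: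
  assumes "z \<in> grid_cell \<delta> c" "w \<in> grid_cell \<delta> c" shows "dist z w \<le> 2 * \<delta>"
proof -
  have "\<bar>Re (z - w)\<bar> \<le> \<delta>" "\<bar>Im (z - w)\<bar> \<le> \<delta>"
    using assms by (auto simp: grid_cell_def algebra_simps)
  then show ?thesis using cmod_le[of "z - w"] by (simp add: dist_norm)
qed

lemma finite_cells_meeting_bounded:
  assumes "\<delta> > 0" "bounded S" shows "finite {c. grid_cell \<delta> c \<inter> S \<noteq> {}}"
proof -
  obtain M where M: "\<And>z. z \<in> S \<Longrightarrow> norm z \<le> M" using assms(2) by (auto simp: bounded_iff)
  define N where "N = \<lceil>M / \<delta>\<rceil> + 1"
  have N: "M / \<delta> \<le> of_int N - 1" unfolding N_def by linarith
  have *: "i \<in> {- N..N}" if "of_int i * \<delta> \<le> x" "x \<le> of_int (i + 1) * \<delta>" "\<bar>x\<bar> \<le> M" for i x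
  proof -
    have "of_int i \<le> M / \<delta>" using that assms(1) by (simp add: pos_le_divide_eq)
    moreover have "(- M) / \<delta> \<le> of_int (i + 1)"
      unfolding pos_divide_le_eq[OF assms(1)] using that by linarith
    ultimately have "of_int i \<le> (of_int N :: real)" "(of_int (- N) :: real) \<le> of_int i"
      using N by simp_all
    then show ?thesis by (simp only: of_int_le_iff atLeastAtMost_iff)
  qed
  have "{c. grid_cell \<delta> c \<inter> S \<noteq> {}} \<subseteq> {- N..N} \<times> {- N..N}"
  proof
    fix c assume "c \<in> {c. grid_cell \<delta> c \<inter> S \<noteq> {}}"
    then obtain z where z: "z \<in> grid_cell \<delta> c" "z \<in> S" by blast
    have "\<bar>Re z\<bar> \<le> M" "\<bar>Im z\<bar> \<le> M"
      using M[OF z(2)] abs_Re_le_cmod[of z] abs_Im_le_cmod[of z] by auto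
    then have "fst c \<in> {- N..N}" "snd c \<in> {- N..N}"
      using z(1) * unfolding grid_cell_def by blast+
    then show "c \<in> {- N..N} \<times> {- N..N}" by (simp add: mem_Times_iff)
  qed
  then show ?thesis by (rule finite_subset) simp
qed

lemma grid_cell_box_unique:
  assumes "\<delta> > 0" "w \<in> box (Complex (of_int (fst c) * \<delta>) (of_int (snd c) * \<delta>))
                       (Complex (of_int (fst c + 1) * \<delta>) (of_int (snd c + 1) * \<delta>))"
    "w \<in> grid_cell \<delta> c'"
  shows "c' = c"
proof -
  have *: "i = j" if "of_int i * \<delta> < x" "x < of_int (i + 1) * \<delta>" "of_int j * \<delta> \<le> x" "x \<le> of_int (j + 1) * \<delta>"
    for i j x
  proof -
    have "of_int j * \<delta> < of_int (i + 1) * \<delta>" "of_int i * \<delta> < of_int (j + 1) * \<delta>" using that by linarith+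
    then have "j < i + 1" "i < j + 1" using assms(1) by (simp_all only: of_int_less_iff mult_less_cancel_right_pos)
    then show ?thesis by simp
  qed
  have "fst c = fst c'" "snd c = snd c'"
    using assms(2,3) * unfolding grid_cell_def in_box_complex_iff by auto
  then show ?thesis by (simp add: prod_eq_iff)
qed

text \<open>
  The filled region is again a union of squares: a square that contains a point of a hole and is
  not one of the given squares has its interior inside the hole.
\<close>

lemma filled_region_props:
  assumes J: "compact J" "connected J" "J \<noteq> {}" and \<delta>: "\<delta> > 0"
  shows cball_subset_filled_region: "\<And>z. z \<in> J \<Longrightarrow> cball z \<delta> \<subseteq> filled_region J \<delta>"
    and nearby_region_near: "\<And>w. w \<in> nearby_region J \<delta> \<Longrightarrow> \<exists>z\<in>J. dist z w \<le> 3 * \<delta>"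
    and hadamard_filled_region: "hadamard_region (filled_region J \<delta>)"
proof -
  let ?T = "nearby_cells J \<delta>" and ?U = "nearby_region J \<delta>" and ?P = "filled_region J \<delta>"
  show near: "\<exists>z\<in>J. dist z w \<le> 3 * \<delta>" if "w \<in> ?U" for w
  proof -
    obtain c z v where c: "w \<in> grid_cell \<delta> c" "z \<in> J" "v \<in> grid_cell \<delta> c" "dist z v \<le> \<delta>"
      using \<open>w \<in> ?U\<close> unfolding grid_cells_def nearby_cells_def by blast
    then have "dist z w \<le> \<delta> + 2 * \<delta>"
      using dist_triangle[of z w v] dist_grid_cell[of v \<delta> c w] by linarith
    then show ?thesis using c(2) by auto
  qed
  define N where "N = (\<Union>z\<in>J. cball z \<delta>)"
  have NU: "N \<subseteq> ?U"
  proof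
    fix w assume "w \<in> N"
    then obtain z where z: "z \<in> J" "dist z w \<le> \<delta>" by (auto simp: N_def)
    have w: "w \<in> grid_cell \<delta> (\<lfloor>Re w / \<delta>\<rfloor>, \<lfloor>Im w / \<delta>\<rfloor>)" by (rule mem_grid_cell_floor[OF \<delta>])
    then have "(\<lfloor>Re w / \<delta>\<rfloor>, \<lfloor>Im w / \<delta>\<rfloor>) \<in> ?T" using z unfolding nearby_cells_def by blast
    then show "w \<in> ?U" using w unfolding grid_cells_def by blast
  qed
  have UP: "?U \<union> inside ?U = ?P" by (simp add: filled_region_def union_with_inside)
  show "cball z \<delta> \<subseteq> ?P" if "z \<in> J" for z using NU UP that by (auto simp: N_def)
  have "bounded ?U"
  proof -
    obtain M where M: "\<And>z. z \<in> J \<Longrightarrow> norm z \<le> M"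
      using compact_imp_bounded[OF J(1)] by (auto simp: bounded_iff)
    have "norm w \<le> M + 3 * \<delta>" if wU: "w \<in> ?U" for w
    proof -
      obtain z where "z \<in> J" "dist z w \<le> 3 * \<delta>" using near[OF wU] by blast
      then show ?thesis using M[of z] norm_triangle_sub[of w z] by (simp add: dist_norm norm_minus_commute)
    qed
    then show ?thesis by (auto simp: bounded_iff)
  qed
  have finT: "finite ?T"
  proof (rule finite_subset)
    show "?T \<subseteq> {c. grid_cell \<delta> c \<inter> ?U \<noteq> {}}"
      using grid_cell_nonempty[OF \<delta>] unfolding grid_cells_def by blast
  qed (rule finite_cells_meeting_bounded[OF \<delta> \<open>bounded ?U\<close>])
  have "closed ?U" using compact_grid_cells[OF finT] compact_imp_closed by blast
  have "connected N"
  proof -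
    have "N = \<Union>((\<lambda>z. J \<union> cball z \<delta>) ` J)" using \<delta> by (auto simp: N_def)
    moreover have "connected (\<Union>((\<lambda>z. J \<union> cball z \<delta>) ` J))"
    proof (rule connected_Union)
      fix s assume "s \<in> (\<lambda>z. J \<union> cball z \<delta>) ` J"
      then obtain z where "z \<in> J" "s = J \<union> cball z \<delta>" by blast
      then show "connected s" using J(2) \<delta> by (auto intro!: connected_Un)
    qed (use J(3) in blast)
    ultimately show ?thesis by simp
  qed
  have "N \<noteq> {}" using J(3) \<delta> by (auto simp: N_def)
  have "connected ?U"
  proof -
    have "?U = \<Union>(insert N ((\<lambda>c. N \<union> grid_cell \<delta> c) ` ?T))" using NU unfolding grid_cells_def by blast
    moreover have "connected (\<Union>(insert N ((\<lambda>c. N \<union> grid_cell \<delta> c) ` ?T)))"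
    proof (rule connected_Union)
      fix s assume s: "s \<in> insert N ((\<lambda>c. N \<union> grid_cell \<delta> c) ` ?T)"
      have "N \<inter> grid_cell \<delta> c \<noteq> {}" if "c \<in> ?T" for c
      proof -
        obtain z w where "z \<in> J" "w \<in> grid_cell \<delta> c" "dist z w \<le> \<delta>"
          using \<open>c \<in> ?T\<close> unfolding nearby_cells_def by blast
        then have "w \<in> N \<inter> grid_cell \<delta> c" by (auto simp: N_def)
        then show ?thesis by blast
      qed
      then show "connected s"
        using s \<open>connected N\<close> convex_connected[OF convex_grid_cell] by (auto intro!: connected_Un)
    qed (use \<open>N \<noteq> {}\<close> in blast)
    ultimately show ?thesis by simp
  qed
  have "closed ?P"
    unfolding filled_region_def using open_outside[OF \<open>closed ?U\<close>] by (simp add: closed_Compl)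
  have "bounded ?P" using \<open>bounded ?U\<close> bounded_inside UP by (metis bounded_Un)
  have "connected ?P" using connected_with_inside[OF \<open>closed ?U\<close> \<open>connected ?U\<close>] UP by simp
  have "connected (- ?P)"
    unfolding filled_region_def using connected_outside[OF \<open>bounded ?U\<close>] by simp
  define S where "S = {c. grid_cell \<delta> c \<subseteq> ?P}"
  have "finite S"
  proof (rule finite_subset)
    show "S \<subseteq> {c. grid_cell \<delta> c \<inter> ?P \<noteq> {}}"
      using grid_cell_nonempty[OF \<delta>] unfolding S_def by blast
  qed (rule finite_cells_meeting_bounded[OF \<delta> \<open>bounded ?P\<close>])
  have PS: "?P = grid_cells \<delta> S"
  proof
    show "?P \<subseteq> grid_cells \<delta> S"
    proof
      fix z assume "z \<in> ?P"
      show "z \<in> grid_cells \<delta> S"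
      proof (cases "z \<in> ?U")
        case True
        then obtain c where c: "c \<in> ?T" "z \<in> grid_cell \<delta> c" unfolding grid_cells_def by blast
        then have "grid_cell \<delta> c \<subseteq> ?P" using UP unfolding grid_cells_def by blast
        then show ?thesis using c unfolding S_def grid_cells_def by blast
      next
        case False
        then have zin: "z \<in> inside ?U" using \<open>z \<in> ?P\<close> UP by blast
        define c where "c = (\<lfloor>Re z / \<delta>\<rfloor>, \<lfloor>Im z / \<delta>\<rfloor>)"
        have zc: "z \<in> grid_cell \<delta> c" unfolding c_def by (rule mem_grid_cell_floor[OF \<delta>])
        have cT: "c \<notin> ?T" using False zc unfolding grid_cells_def by blast
        define B where "B = box (Complex (of_int (fst c) * \<delta>) (of_int (snd c) * \<delta>))
                       (Complex (of_int (fst c + 1) * \<delta>) (of_int (snd c + 1) * \<delta>))"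
        have BU: "B \<inter> ?U = {}"
          using grid_cell_box_unique[OF \<delta>] cT unfolding B_def grid_cells_def by blast
        have "Complex ((of_int (fst c) + 1/2) * \<delta>) ((of_int (snd c) + 1/2) * \<delta>) \<in> B"
          using \<delta> by (simp add: B_def in_box_complex_iff algebra_simps)
        then have clB: "closure B = grid_cell \<delta> c"
          unfolding B_def grid_cell_eq_cbox by (intro closure_box) blast
        have "connected (insert z B)"
        proof (rule connected_intermediate_closure)
          show "connected B" unfolding B_def by (simp add: convex_connected convex_box)
          show "insert z B \<subseteq> closure B" using zc clB closure_subset by auto
        qed auto
        then have "connected_component (- ?U) z w" if "w \<in> B" for w
          unfolding connected_component_def using BU False that
          by (intro exI[of _ "insert z B"]) blast
        then have "B \<subseteq> inside ?U" using zin inside_same_component by blast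
        then have "closure B \<subseteq> ?P" using \<open>closed ?P\<close> UP by (intro closure_minimal) blast
        then show ?thesis using zc clB unfolding S_def grid_cells_def by blast
      qed
    qed
  qed (auto simp: S_def grid_cells_def)
  have "?P \<noteq> {}" using UP NU \<open>N \<noteq> {}\<close> by blast
  then have "S \<noteq> {}" using PS by (auto simp: grid_cells_def)
  show "hadamard_region ?P"
    using hadamard_region_grid_cells[OF \<delta> \<open>finite S\<close> \<open>S \<noteq> {}\<close>] \<open>connected ?P\<close> \<open>connected (- ?P)\<close> PS by simp
qed

lemma filled_region_subset_cball:
  assumes J: "compact J" "connected J" "J \<noteq> {}" and \<delta>: "\<delta> > 0" and M: "J \<subseteq> cball 0 M"
  shows "filled_region J \<delta> \<subseteq> cball 0 (M + 3 * \<delta>)"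
proof -
  have "nearby_region J \<delta> \<subseteq> cball 0 (M + 3 * \<delta>)"
  proof
    fix w assume "w \<in> nearby_region J \<delta>"
    then obtain z where "z \<in> J" "dist z w \<le> 3 * \<delta>" using nearby_region_near[OF J \<delta>] by blast
    then show "w \<in> cball 0 (M + 3 * \<delta>)"
      using M norm_triangle_sub[of w z] by (fastforce simp: dist_norm norm_minus_commute)
  qed
  then have "- cball 0 (M + 3 * \<delta>) \<subseteq> outside (nearby_region J \<delta>)"
    by (intro outside_subset_convex) auto
  then show ?thesis unfolding filled_region_def by blast
qed

text \<open>
  A point \<open>a\<close> outside \<open>J\<close> can be joined to a remote point by a path that stays away from \<open>J\<close>. As soon as
  the squares are small compared with the distance of the path from \<open>J\<close>, neither the path nor a
  neighbourhood of \<open>a\<close> meets the squares near \<open>J\<close>, and points close to \<open>a\<close> do not belong to the filled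
  region.
\<close>

lemma filled_region_limit:
  assumes J: "compact J" "connected J" "J \<noteq> {}" and coJ: "connected (- J)"
    and \<delta>: "\<And>k. \<delta> k > 0" "\<delta> \<longlonglongrightarrow> 0" and z: "\<And>k. z k \<in> filled_region J (\<delta> k)" "z \<longlonglongrightarrow> a"
  shows "a \<in> J"
proof (rule ccontr)
  assume "a \<notin> J"
  obtain M where M: "0 < M" "J \<subseteq> cball 0 M"
    using compact_imp_bounded[OF J(1)] unfolding bounded_pos by (auto simp: subset_iff)
  define w where "w = complex_of_real (M + 4)"
  have nw: "norm w = M + 4" using M(1) by (simp add: w_def)
  then have "w \<notin> J" using M(2) by auto
  have "path_connected (- J)"
    using coJ J(1) compact_imp_closed connected_open_path_connected by (metis open_Compl)
  then obtain \<gamma> where \<gamma>: "path \<gamma>" "path_image \<gamma> \<subseteq> - J" "pathstart \<gamma> = a" "pathfinish \<gamma> = w"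
    unfolding path_connected_def using \<open>a \<notin> J\<close> \<open>w \<notin> J\<close> by (metis ComplI)
  obtain \<eta> where \<eta>: "\<eta> > 0" "\<And>p q. p \<in> path_image \<gamma> \<Longrightarrow> q \<in> J \<Longrightarrow> \<eta> \<le> dist p q"
    using separate_compact_closed[OF compact_path_image[OF \<gamma>(1)] compact_imp_closed[OF J(1)]] \<gamma>(2) by blast
  have "\<forall>\<^sub>F k in sequentially. dist (z k) a < \<eta> / 2" using z(2) \<eta>(1) by (intro tendstoD) auto
  moreover have "\<forall>\<^sub>F k in sequentially. \<delta> k < min (\<eta> / 6) 1"
    using \<delta>(2) \<eta>(1) by (intro order_tendstoD) auto
  ultimately have "\<forall>\<^sub>F k in sequentially. dist (z k) a < \<eta> / 2 \<and> \<delta> k < min (\<eta> / 6) 1"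
    by (rule eventually_conj)
  then obtain k where k: "dist (z k) a < \<eta> / 2" "\<delta> k < \<eta> / 6" "\<delta> k < 1"
    by (auto simp: eventually_sequentially)
  let ?U = "nearby_region J (\<delta> k)"
  define G where "G = path_image \<gamma> \<union> closed_segment a (z k)"
  have "a \<in> path_image \<gamma>" using \<gamma>(3) pathstart_in_path_image by blast
  then have "connected G"
    unfolding G_def using connected_path_image[OF \<gamma>(1)] by (intro connected_Un) auto
  have far: "\<eta> / 2 < dist q g" if "g \<in> G" "q \<in> J" for g q
    using that(1) unfolding G_def
  proof
    assume "g \<in> path_image \<gamma>"
    then show ?thesis using \<eta>(1) \<eta>(2)[of g q] that(2) by (simp add: dist_commute)
  next
    assume "g \<in> closed_segment a (z k)"
    then have "dist g a \<le> dist a (z k)" using dist_in_closed_segment by blast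
    moreover have "\<eta> \<le> dist a q" using \<eta>(2)[OF \<open>a \<in> path_image \<gamma>\<close> that(2)] .
    ultimately show ?thesis
      using k(1) dist_triangle[of a q g] by (simp add: dist_commute)
  qed
  have "G \<inter> ?U = {}"
  proof (rule ccontr)
    assume "G \<inter> ?U \<noteq> {}"
    then obtain g where g: "g \<in> G" "g \<in> ?U" by blast
    then obtain q where "q \<in> J" "dist q g \<le> 3 * \<delta> k" using nearby_region_near[OF J \<delta>(1)] by blast
    then show False using far[OF g(1)] k(2) by fastforce
  qed
  moreover have "w \<in> G" "z k \<in> G" using \<gamma>(4) pathfinish_in_path_image by (auto simp: G_def)
  ultimately have "connected_component (- ?U) w (z k)"
    unfolding connected_component_def using \<open>connected G\<close> by (intro exI[of _ G]) blast
  moreover have "w \<in> outside ?U"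
  proof -
    have "filled_region J (\<delta> k) \<subseteq> cball 0 (M + 3 * \<delta> k)"
      using filled_region_subset_cball[OF J \<delta>(1) M(2)] .
    moreover have "w \<notin> cball 0 (M + 3 * \<delta> k)" using nw k(3) by simp
    ultimately show ?thesis unfolding filled_region_def by blast
  qed
  ultimately have "z k \<in> outside ?U" using outside_same_component by blast
  then show False using z(1)[of k] by (simp add: filled_region_def)
qed

text \<open>
  The regions need not be nested; \<open>limit_mem\<close>, stated for all subsequences, says that they
  accumulate only at \<open>J\<close>.
\<close>

locale outer_approximation =
  fixes J :: "complex set" and P :: "nat \<Rightarrow> complex set"
  assumes region: "\<And>k. hadamard_region (P k)"
    and neighbourhood: "\<And>k. \<exists>r>0. \<forall>z\<in>J. cball z r \<subseteq> P k"
    and bounded_regions: "bounded (\<Union>k. P k)"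
    and limit_mem: "\<And>s z a. \<lbrakk>strict_mono (s :: nat \<Rightarrow> nat); \<And>k. z k \<in> P (s k); z \<longlonglongrightarrow> a\<rbrakk> \<Longrightarrow> a \<in> J"

lemma exists_outer_approximation:
  assumes J: "compact J" "connected J" "J \<noteq> {}" and coJ: "connected (- J)"
  shows "\<exists>P. outer_approximation J P"
proof -
  define \<delta> where "\<delta> k = inverse (real (Suc k))" for k
  have \<delta>: "\<delta> k > 0" for k by (simp add: \<delta>_def)
  have lim: "\<delta> \<longlonglongrightarrow> 0" unfolding \<delta>_def by (rule LIMSEQ_inverse_real_of_nat)
  obtain M where M: "J \<subseteq> cball 0 M"
    using compact_imp_bounded[OF J(1)] unfolding bounded_iff by (auto simp: subset_iff)
  have "outer_approximation J (\<lambda>k. filled_region J (\<delta> k))"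
  proof
    show "hadamard_region (filled_region J (\<delta> k))" for k by (rule hadamard_filled_region[OF J \<delta>])
    show "\<exists>r>0. \<forall>z\<in>J. cball z r \<subseteq> filled_region J (\<delta> k)" for k
      using cball_subset_filled_region[OF J \<delta>] \<delta> by blast
    have "filled_region J (\<delta> k) \<subseteq> cball 0 (M + 3)" for k
    proof -
      have "\<delta> k \<le> 1" by (simp add: \<delta>_def field_simps)
      then have "cball (0::complex) (M + 3 * \<delta> k) \<subseteq> cball 0 (M + 3)" by (intro subset_cball) simp
      then show ?thesis using filled_region_subset_cball[OF J \<delta> M] by blast
    qed
    then show "bounded (\<Union>k. filled_region J (\<delta> k))" by (intro bounded_subset[OF bounded_cball]) blast
    show "a \<in> J" if "strict_mono s" "\<And>k. z k \<in> filled_region J (\<delta> (s k))" "z \<longlonglongrightarrow> a" for s z a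
      using filled_region_limit[OF J coJ, of "\<lambda>k. \<delta> (s k)" z a] \<delta> that
        LIMSEQ_subseq_LIMSEQ[OF lim that(1)] by (simp add: o_def)
  qed
  then show ?thesis by blast
qed

section \<open>Passing to the limit\<close>

lemma curve_length_lipschitz_le:
  assumes "0 \<le> L" "\<And>s t. \<lbrakk>0 \<le> s; s \<le> t; t \<le> 1\<rbrakk> \<Longrightarrow> d (g s) (g t) \<le> L * (t - s)"
  shows "curve_length d g \<le> ennreal L"
  unfolding curve_length_def
proof (rule SUP_least)
  fix ts :: "real list" assume "ts \<in> {ts. sorted ts \<and> set ts \<subseteq> {0..1}}"
  then have ts: "sorted ts" "set ts \<subseteq> {0..1}" by auto
  show "(\<Sum>i<length ts - 1. ennreal (d (g (ts ! i)) (g (ts ! Suc i)))) \<le> ennreal L"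
  proof (cases "ts = []")
    case False
    have nth: "0 \<le> ts ! i" "ts ! i \<le> 1" if "i < length ts" for i
      using ts(2) nth_mem[OF that] by auto
    have step: "ts ! i \<le> ts ! Suc i" if "i < length ts - 1" for i
      using sorted_nth_mono[OF ts(1), of i "Suc i"] that by simp
    have "(\<Sum>i<length ts - 1. ennreal (d (g (ts ! i)) (g (ts ! Suc i)))) \<le>
        (\<Sum>i<length ts - 1. ennreal (L * (ts ! Suc i - ts ! i)))"
      using assms(2) nth step by (intro sum_mono ennreal_leI) auto
    also have "\<dots> = ennreal (\<Sum>i<length ts - 1. L * (ts ! Suc i - ts ! i))"
      using assms(1) step by (intro sum_ennreal) auto
    also have "(\<Sum>i<length ts - 1. L * (ts ! Suc i - ts ! i)) = L * (ts ! (length ts - 1) - ts ! 0)"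
      by (simp only: sum_distrib_left[symmetric] sum_lessThan_telescope[of "\<lambda>i. ts ! i"])
    also have "\<dots> \<le> L * 1"
      using nth[of 0] nth[of "length ts - 1"] False assms(1) by (intro mult_left_mono) auto
    finally show ?thesis by (simp add: ennreal_leI)
  qed simp
qed

lemma sum_le_curve_length:
  assumes "sorted ts" "set ts \<subseteq> {0..1}"
  shows "(\<Sum>i<length ts - 1. ennreal (d (g (ts ! i)) (g (ts ! Suc i)))) \<le> curve_length d g"
  unfolding curve_length_def using assms by (intro SUP_upper) auto

lemma reach_imp_curve:
  assumes "reach J x y L" shows "\<exists>g\<in>curves_in J x y. curve_length dist g \<le> ennreal L"
proof -
  obtain g where g: "1-lipschitz_on {0..L} g" "g ` {0..L} \<subseteq> J" "g 0 = x" "g L = y" "0 \<le> L"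
    using assms unfolding reach_def by blast
  let ?h = "\<lambda>t. g (t * L)"
  have tL: "t * L \<in> {0..L}" if "t \<in> {0..1}" for t
    using that g(5) mult_left_le_one_le[of L t] by auto
  have "continuous_on {0..1} (g \<circ> (\<lambda>t. t * L))"
    using tL by (intro continuous_on_compose continuous_intros
        continuous_on_subset[OF lipschitz_on_continuous_on[OF g(1)]]) auto
  then have "path ?h" by (simp add: path_def o_def)
  moreover have "path_image ?h \<subseteq> J" using g(2) tL unfolding path_image_def by blast
  ultimately have "?h \<in> curves_in J x y"
    using g(3,4) by (simp add: curves_in_def pathstart_def pathfinish_def)
  moreover have "curve_length dist ?h \<le> ennreal L"
  proof (rule curve_length_lipschitz_le[OF g(5)])
    fix s t :: real assume st: "0 \<le> s" "s \<le> t" "t \<le> 1"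
    then have "s * L \<le> t * L" using g(5) by (intro mult_right_mono) auto
    then show "dist (g (s * L)) (g (t * L)) \<le> L * (t - s)"
      using lipschitz_onD[OF g(1) tL[of s] tL[of t]] st by (auto simp: dist_real_def algebra_simps)
  qed
  ultimately show ?thesis by blast
qed

text \<open>
  A polygon inscribed in the curve is not longer than the curve, and it stays in a given
  neighbourhood of \<open>J\<close> if the subdivision is fine enough. Thus no parametrisation by arc length is
  needed.
\<close>

lemma curve_imp_reach_neighbourhood:
  assumes g: "g \<in> curves_in J x y" and len: "curve_length dist g \<le> ennreal L" "0 \<le> L"
    and r: "r > 0" "\<And>z. z \<in> J \<Longrightarrow> cball z r \<subseteq> P"
  shows "reach P x y L"
proof -
  have g': "path g" "path_image g \<subseteq> J" "g 0 = x" "g 1 = y"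
    using g by (auto simp: curves_in_def pathstart_def pathfinish_def)
  have "uniformly_continuous_on {0..1} g"
    using g'(1) unfolding path_def by (intro compact_uniformly_continuous) auto
  then obtain e where e: "e > 0" "\<And>s t. \<lbrakk>s \<in> {0..1}; t \<in> {0..1}; dist t s < e\<rbrakk> \<Longrightarrow> dist (g t) (g s) < r"
    using r(1) unfolding uniformly_continuous_on_def by metis
  obtain n where n: "inverse (real (Suc n)) < e" using reals_Archimedean[OF e(1)] by blast
  define N where "N = Suc n"
  define t where "t i = real i / real N" for i
  have N: "N > 0" "1 / real N < e" using n by (auto simp: N_def inverse_eq_divide)
  have t01: "t i \<in> {0..1}" if "i \<le> N" for i using that N(1) by (auto simp: t_def)
  have gJ: "g (t i) \<in> J" if "i \<le> N" for i using g'(2) t01[OF that] unfolding path_image_def by blast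
  have seg: "reach P (g (t i)) (g (t (Suc i))) (dist (g (t i)) (g (t (Suc i))))" if "i < N" for i
  proof (rule reach_segment)
    have "dist (t (Suc i)) (t i) = 1 / real N" by (simp add: t_def dist_real_def add_divide_distrib)
    then have "dist (g (t (Suc i))) (g (t i)) < r"
      using e(2)[of "t i" "t (Suc i)"] t01[of i] t01[of "Suc i"] N(2) that by auto
    then have "closed_segment (g (t i)) (g (t (Suc i))) \<subseteq> cball (g (t i)) r"
      using r(1) by (intro closed_segment_subset) (auto simp: dist_commute)
    then show "closed_segment (g (t i)) (g (t (Suc i))) \<subseteq> P" using r(2) gJ[of i] that by fastforce
  qed
  have "reach P (g (t 0)) (g (t m)) (\<Sum>i<m. dist (g (t i)) (g (t (Suc i))))" if "m \<le> N" for m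
    using that
  proof (induction m)
    case 0
    have "g (t 0) \<in> P" using r(2)[OF gJ[of 0]] r(1) by (simp add: subset_iff)
    then show ?case by (simp add: reach_const)
  next
    case (Suc m)
    then show ?case using reach_trans[OF _ seg[of m]] by simp
  qed
  from this[of N] have 1: "reach P x y (\<Sum>i<N. dist (g (t i)) (g (t (Suc i))))"
    using g'(3,4) N(1) by (simp add: t_def)
  let ?ts = "map t [0..<Suc N]"
  have "(\<Sum>i<length ?ts - 1. ennreal (dist (g (?ts ! i)) (g (?ts ! Suc i)))) \<le> curve_length dist g"
  proof (rule sum_le_curve_length)
    show "sorted ?ts" unfolding sorted_map
      by (rule sorted_wrt_mono_rel[OF _ sorted_upt]) (auto simp: t_def divide_right_mono)
    show "set ?ts \<subseteq> {0..1}" using t01 by fastforce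
  qed
  also have "(\<Sum>i<length ?ts - 1. ennreal (dist (g (?ts ! i)) (g (?ts ! Suc i)))) =
      (\<Sum>i<N. ennreal (dist (g (t i)) (g (t (Suc i)))))"
    by (rule sum.cong) (auto simp del: upt_Suc)
  also have "\<dots> = ennreal (\<Sum>i<N. dist (g (t i)) (g (t (Suc i))))" by (rule sum_ennreal) auto
  finally have "(\<Sum>i<N. dist (g (t i)) (g (t (Suc i)))) \<le> L"
    using len by (meson ennreal_le_iff order_trans)
  then show ?thesis using reach_mono[OF 1] by blast
qed

context outer_approximation
begin

lemma J_subset: "J \<subseteq> P k"
  using neighbourhood[of k] by fastforce

text \<open>
  Compactness and lower semicontinuity of length in one statement: Lipschitz curves with bounded
  images have a uniformly convergent subsequence, and the limit runs in \<open>J\<close>.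
\<close>

lemma reach_limit:
  assumes s: "strict_mono (s :: nat \<Rightarrow> nat)" and r: "\<And>k. reach (P (s k)) (x k) (y k) (L k)"
    and lim: "x \<longlonglongrightarrow> a" "y \<longlonglongrightarrow> b" "L \<longlonglongrightarrow> l"
  shows "reach J a b l"
proof -
  have "l \<ge> 0" using LIMSEQ_le_const[OF lim(3)] reach_nonneg[OF r] by blast
  have "\<exists>g. 1-lipschitz_on {0..L k} g \<and> g ` {0..L k} \<subseteq> P (s k) \<and> g 0 = x k \<and> g (L k) = y k" for k
    using r[of k] unfolding reach_def by blast
  then obtain g where g: "\<And>k. 1-lipschitz_on {0..L k} (g k)" "\<And>k. g k ` {0..L k} \<subseteq> P (s k)"
    "\<And>k. g k 0 = x k" "\<And>k. g k (L k) = y k" by metis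
  have L0: "0 \<le> L k" for k using reach_nonneg[OF r] .
  \<comment> \<open>The curves are cut off or prolonged by their end points so that all are defined on \<open>{0..l}\<close>.\<close>
  define G where "G k t = g k (min t (L k))" for k t
  have GP: "G k t \<in> P (s k)" if "0 \<le> t" for k t
    using g(2)[of k] that L0[of k] by (auto simp: G_def image_subset_iff)
  have G1: "dist (G k t) (G k u) \<le> dist t u" if "0 \<le> t" "0 \<le> u" for k t u
    using lipschitz_onD[OF g(1)[of k], of "min t (L k)" "min u (L k)"] that L0[of k]
    by (auto simp: G_def dist_real_def min_def split: if_splits)
  obtain M where M: "\<And>z k. z \<in> P k \<Longrightarrow> norm z \<le> M"
    using bounded_regions by (auto simp: bounded_iff)
  obtain h m where h: "strict_mono (m :: nat \<Rightarrow> nat)"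
    "\<And>e. 0 < e \<Longrightarrow> \<exists>N. \<forall>n t. n \<ge> N \<and> t \<in> {0..l} \<longrightarrow> norm (G (m n) t - h t) < e"
  proof (rule Arzela_Ascoli[of "{0..l}" G M])
    show "norm (G n t) \<le> M" if "t \<in> {0..l}" for n t using M[OF GP] that by auto
    show "\<exists>d>0. \<forall>n u. u \<in> {0..l} \<and> norm (t - u) < d \<longrightarrow> norm (G n t - G n u) < e"
      if "t \<in> {0..l}" "0 < e" for t e
      using that G1[of t] by (intro exI[of _ e]) (auto simp: dist_norm intro: le_less_trans)
  qed auto
  have conv: "(\<lambda>n. G (m n) t) \<longlonglongrightarrow> h t" if "t \<in> {0..l}" for t
    using h(2) that unfolding LIMSEQ_def dist_norm by metis
  have sm: "strict_mono (s \<circ> m)" using s h(1) by (rule strict_mono_o)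
  have limm: "(\<lambda>n. x (m n)) \<longlonglongrightarrow> a" "(\<lambda>n. y (m n)) \<longlonglongrightarrow> b" "(\<lambda>n. L (m n)) \<longlonglongrightarrow> l"
    using lim LIMSEQ_subseq_LIMSEQ[OF _ h(1)] by (auto simp: o_def)
  show ?thesis
    unfolding reach_def
  proof (intro conjI exI[of _ h])
    show "1-lipschitz_on {0..l} h"
    proof (rule lipschitz_onI)
      fix t u assume tu: "t \<in> {0..l}" "u \<in> {0..l}"
      have "(\<lambda>n. dist (G (m n) t) (G (m n) u)) \<longlonglongrightarrow> dist (h t) (h u)"
        using conv tu by (intro tendsto_dist) auto
      then show "dist (h t) (h u) \<le> 1 * dist t u"
        by (rule LIMSEQ_le_const2) (use G1 tu in auto)
    qed simp
    show "h ` {0..l} \<subseteq> J"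
    proof
      fix z assume "z \<in> h ` {0..l}"
      then obtain t where t: "t \<in> {0..l}" "z = h t" by blast
      have "G (m k) t \<in> P ((s \<circ> m) k)" for k using GP[of t "m k"] t(1) by simp
      then show "z \<in> J" using limit_mem[OF sm _ conv[OF t(1)]] t(2) by simp
    qed
    have "(\<lambda>n. G (m n) 0) = (\<lambda>n. x (m n))" using g(3) L0 by (auto simp: G_def min_def)
    then show "h 0 = a" using conv[of 0] limm(1) \<open>l \<ge> 0\<close> LIMSEQ_unique by fastforce
    have "(\<lambda>n. L (m n) - l) \<longlonglongrightarrow> 0" using limm(3) by (simp add: LIM_zero)
    then have "(\<lambda>n. \<bar>L (m n) - l\<bar>) \<longlonglongrightarrow> 0" by (rule tendsto_rabs_zero)
    moreover have "norm (G (m n) l - y (m n)) \<le> \<bar>L (m n) - l\<bar>" for n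
      using lipschitz_onD[OF g(1)[of "m n"], of "min l (L (m n))" "L (m n)"] L0[of "m n"] \<open>l \<ge> 0\<close> g(4)[of "m n"]
      by (auto simp: G_def dist_norm min_def split: if_splits)
    ultimately have "(\<lambda>n. G (m n) l - y (m n)) \<longlonglongrightarrow> 0"
      using Lim_null_comparison[of "\<lambda>n. G (m n) l - y (m n)" "\<lambda>n. \<bar>L (m n) - l\<bar>" sequentially]
      by simp
    from tendsto_add[OF this limm(2)] have "(\<lambda>n. G (m n) l) \<longlonglongrightarrow> b" by simp
    then show "h l = b" using conv[of l] \<open>l \<ge> 0\<close> LIMSEQ_unique by fastforce
  qed (rule \<open>l \<ge> 0\<close>)
qed

lemma reach_limit_J:
  assumes "\<And>k. reach J (x k) (y k) (L k)" "x \<longlonglongrightarrow> a" "y \<longlonglongrightarrow> b" "L \<longlonglongrightarrow> l"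
  shows "reach J a b l"
  using reach_limit[of id x y L a b l] assms reach_subset[OF _ J_subset] by (simp add: strict_mono_def)

lemma LIMSEQ_add_inverse: "(\<lambda>k. c + inverse (real (Suc k))) \<longlonglongrightarrow> c"
  using tendsto_add[OF tendsto_const LIMSEQ_inverse_real_of_nat, of c] by simp

lemma reach_lipdist_attained:
  assumes "reach J x y L" shows "reach J x y (lipdist J x y)"
proof (rule reach_limit_J[OF _ tendsto_const tendsto_const LIMSEQ_add_inverse])
  show "reach J x y (lipdist J x y + inverse (real (Suc k)))" for k
    by (rule reach_lipdist[OF assms]) simp
qed

text \<open>
  The curve is replaced by polygons in the approximating regions, and these by a limit of polygons
  in \<open>J\<close>.
\<close>

lemma curve_imp_reach:
  assumes "g \<in> curves_in J x y" "curve_length dist g \<le> ennreal L" "0 \<le> L" shows "reach J x y L"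
proof (rule reach_limit[of id "\<lambda>_. x" "\<lambda>_. y" "\<lambda>_. L"])
  fix k
  obtain r where "r > 0" "\<forall>z\<in>J. cball z r \<subseteq> P k" using neighbourhood by blast
  then show "reach (P (id k)) x y L" using curve_imp_reach_neighbourhood[OF assms] by simp
qed (auto simp: strict_mono_def)

lemma length_metric_eq_lipdist: "length_metric J = lipdist J"
proof (intro ext)
  fix x y
  let ?I = "INF g\<in>curves_in J x y. curve_length dist g"
  show "length_metric J x y = lipdist J x y"
  proof (cases "\<exists>L. reach J x y L")
    case True
    then have "reach J x y (lipdist J x y)" using reach_lipdist_attained by blast
    then obtain g where "g \<in> curves_in J x y" "curve_length dist g \<le> ennreal (lipdist J x y)"
      using reach_imp_curve by blast
    then have "?I \<le> ennreal (lipdist J x y)" by (rule INF_lower2[of g _ "curve_length dist"])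
    moreover have "ennreal (lipdist J x y) \<le> ?I"
    proof (rule INF_greatest)
      fix g assume g: "g \<in> curves_in J x y"
      show "ennreal (lipdist J x y) \<le> curve_length dist g"
      proof (cases "curve_length dist g")
        case (real r)
        then have "reach J x y r" using curve_imp_reach[OF g] by simp
        then show ?thesis using real lipdist_le by (simp add: ennreal_leI)
      qed simp
    qed
    ultimately have "?I = ennreal (lipdist J x y)" by (rule antisym)
    then show ?thesis by (simp add: length_metric_def lipdist_nonneg)
  next
    case False
    have "?I = top"
    proof (rule antisym[OF top_greatest INF_greatest])
      fix g assume g: "g \<in> curves_in J x y"
      show "top \<le> curve_length dist g"
      proof (cases "curve_length dist g")
        case (real r)
        then have "reach J x y r" using curve_imp_reach[OF g] by simp
        then show ?thesis using False by blast
      qed simp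
    qed
    then show ?thesis using False by (simp add: length_metric_def lipdist_def)
  qed
qed

text \<open>
  The distances in the regions are at most those in \<open>J\<close>. They cannot stay below a smaller
  constant \<open>c\<close> along a subsequence, since a limit of curves would then join the points within \<open>J\<close> by
  a curve of length at most \<open>c\<close>.
\<close>

lemma lipdist_tendsto:
  assumes "reach J x y L" shows "(\<lambda>k. lipdist (P k) x y) \<longlonglongrightarrow> lipdist J x y"
proof (rule order_tendstoI)
  have le: "lipdist (P k) x y \<le> lipdist J x y" for k
    using lipdist_le[OF reach_subset[OF reach_lipdist_attained[OF assms] J_subset]] .
  fix c assume "lipdist J x y < c"
  then show "\<forall>\<^sub>F k in sequentially. lipdist (P k) x y < c"
    using le by (intro always_eventually) (metis le_less_trans)
next
  fix c assume c: "c < lipdist J x y"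
  show "\<forall>\<^sub>F k in sequentially. c < lipdist (P k) x y"
  proof (rule ccontr)
    assume "\<not> ?thesis"
    from not_eventually_sequentiallyD[OF this]
    obtain s :: "nat \<Rightarrow> nat" where s: "strict_mono s" "\<forall>n. \<not> c < lipdist (P (s n)) x y" by blast
    have "reach (P (s n)) x y (c + inverse (real (Suc n)))" for n
    proof (rule reach_mono)
      show "reach (P (s n)) x y (lipdist (P (s n)) x y + inverse (real (Suc n)))"
        using reach_subset[OF assms J_subset] by (rule reach_lipdist) simp
    qed (use s(2) in \<open>simp add: not_less\<close>)
    then have "reach J x y c"
      using reach_limit[OF s(1) _ tendsto_const tendsto_const LIMSEQ_add_inverse] by blast
    then show False using lipdist_le c by fastforce
  qed
qed

text \<open>
  Take the points that divide the sides from \<open>x\<close> to \<open>y\<close> in the approximating regions. Any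
  accumulation point works, simultaneously for all \<open>p\<close>, since the right-hand sides converge and the left-hand
  sides are lower semicontinuous.
\<close>

lemma ratio_point_limit:
  assumes xy: "reach J x y L0" and t: "0 \<le> t" "t \<le> 1"
  shows "\<exists>m. reach J x m (t * lipdist J x y) \<and>
    (\<forall>p L1 L2. reach J p x L1 \<longrightarrow> reach J p y L2 \<longrightarrow>
       (lipdist J p m)\<^sup>2 \<le> (1 - t) * (lipdist J p x)\<^sup>2 + t * (lipdist J p y)\<^sup>2 - t * (1 - t) * (lipdist J x y)\<^sup>2)"
proof -
  let ?D = "lipdist J x y"
  have xyJ: "x \<in> J" "y \<in> J" using reach_mem[OF xy] by auto
  have con: "\<exists>L. reach (P k) u v L" if "u \<in> P k" "v \<in> P k" for u v k
    using region[of k] that unfolding hadamard_region_def lip_connected_def by blast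
  have met: "Metric_space (P k) (lipdist (P k))" for k
    using Metric_space_lipdist[OF order_refl con] .
  have "\<exists>m\<in>P k. lipdist (P k) x m = t * lipdist (P k) x y \<and> lipdist (P k) m y = (1 - t) * lipdist (P k) x y" for k
  proof -
    have "divisible_on (P k) (lipdist (P k))" "x \<in> P k" "y \<in> P k" "t \<in> {0..1}"
      using region[of k] xyJ J_subset[of k] t by (auto simp: hadamard_region_def)
    then show ?thesis unfolding divisible_on_def by blast
  qed
  then obtain m where m: "\<And>k. m k \<in> P k" "\<And>k. lipdist (P k) x (m k) = t * lipdist (P k) x y"
    "\<And>k. lipdist (P k) (m k) y = (1 - t) * lipdist (P k) x y" by metis
  have "compact (closure (\<Union>k. P k))" using bounded_regions by (simp add: compact_closure)
  moreover have "\<forall>k. m k \<in> closure (\<Union>k. P k)" 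
    using m(1) by (intro allI closure_subset[THEN subsetD]) (rule UN_I[OF UNIV_I])
  ultimately obtain q s where s: "strict_mono (s :: nat \<Rightarrow> nat)" "(m \<circ> s) \<longlonglongrightarrow> q"
    unfolding compact_def by blast
  have ms: "(\<lambda>k. m (s k)) \<longlonglongrightarrow> q" using s(2) by (simp add: o_def)
  have sub: "(\<lambda>k. lipdist (P (s k)) u v) \<longlonglongrightarrow> lipdist J u v" if "reach J u v L" for u v L
    using LIMSEQ_subseq_LIMSEQ[OF lipdist_tendsto[OF that] s(1)] by (simp add: o_def)
  have approach: "reach J u q c"
    if u: "u \<in> J" and b: "\<And>k. lipdist (P (s k)) u (m (s k)) \<le> b k" "b \<longlonglongrightarrow> c" for u b c
  proof (rule reach_limit[OF s(1) _ tendsto_const ms])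
    show "reach (P (s k)) u (m (s k)) (b k + inverse (real (Suc k)))" for k
    proof (rule reach_mono)
      obtain L where "reach (P (s k)) u (m (s k)) L"
        using con[OF subsetD[OF J_subset u] m(1)] by blast
      then show "reach (P (s k)) u (m (s k)) (lipdist (P (s k)) u (m (s k)) + inverse (real (Suc k)))"
        by (rule reach_lipdist) simp
    qed (use b(1) in simp)
    show "(\<lambda>k. b k + inverse (real (Suc k))) \<longlonglongrightarrow> c"
      using tendsto_add[OF b(2) LIMSEQ_inverse_real_of_nat] by simp
  qed
  show ?thesis
  proof (intro exI[of _ q] conjI allI impI)
    show "reach J x q (t * ?D)"
      by (rule approach[OF xyJ(1)]) (auto simp: m(2) intro!: tendsto_intros sub[OF xy])
    fix p L1 L2 assume px: "reach J p x L1" and py: "reach J p y L2"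
    have pJ: "p \<in> J" using reach_mem[OF px] by simp
    define R where "R k = (1 - t) * (lipdist (P (s k)) p x)\<^sup>2 + t * (lipdist (P (s k)) p y)\<^sup>2
        - t * (1 - t) * (lipdist (P (s k)) x y)\<^sup>2" for k
    let ?R = "(1 - t) * (lipdist J p x)\<^sup>2 + t * (lipdist J p y)\<^sup>2 - t * (1 - t) * ?D\<^sup>2"
    have R: "R \<longlonglongrightarrow> ?R"
      unfolding R_def by (intro tendsto_intros sub[OF px] sub[OF py] sub[OF xy])
    have sq: "(lipdist (P (s k)) p (m (s k)))\<^sup>2 \<le> R k" for k
      unfolding R_def
    proof (rule stewart_on_ratio[OF met])
      show "stewart_on (P (s k)) (lipdist (P (s k)))" using region unfolding hadamard_region_def by blast
    qed (use m pJ xyJ subsetD[OF J_subset] in auto)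
    have "0 \<le> ?R"
      by (rule LIMSEQ_le_const[OF R]) (metis sq order_trans zero_le_power2)
    have "reach J p q (sqrt ?R)"
    proof (rule approach[OF pJ])
      show "lipdist (P (s k)) p (m (s k)) \<le> sqrt (R k)" for k
        using sq real_le_rsqrt by blast
      show "(\<lambda>k. sqrt (R k)) \<longlonglongrightarrow> sqrt ?R" using R by (rule tendsto_real_sqrt)
    qed
    then have "lipdist J p q \<le> sqrt ?R" by (rule lipdist_le)
    then have "(lipdist J p q)\<^sup>2 \<le> (sqrt ?R)\<^sup>2" using lipdist_nonneg by (intro power_mono)
    then show "(lipdist J p q)\<^sup>2 \<le> ?R" using \<open>0 \<le> ?R\<close> by simp
  qed
qed

end

section \<open>The CAT(0) property\<close>

lemma geodesic_mem:
  assumes "Metric_space X d" "geodesic X d g x y" "t \<in> {0..1}" shows "g t \<in> X"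
proof -
  interpret Metric_space X d by fact
  show ?thesis
    using assms(2,3) continuous_map_funspace[of "top_of_set {0..1}" mtopology g]
    unfolding geodesic_def by auto
qed

lemma geodesic_subdivision:
  assumes "Metric_space X d" "geodesic X d g x y" "0 \<le> s" "s \<le> t" "t \<le> 1"
  shows "d x (g s) + d (g s) (g t) + d (g t) y \<le> d x y"
proof -
  interpret Metric_space X d by fact
  let ?ts = "[0, s, t, 1]"
  have g: "g 0 = x" "g 1 = y" "curve_length d g = ennreal (d x y)"
    using assms(2) by (auto simp: geodesic_def)
  have "(\<Sum>i<length ?ts - 1. ennreal (d (g (?ts ! i)) (g (?ts ! Suc i)))) \<le> ennreal (d x y)"
    unfolding g(3)[symmetric] by (rule sum_le_curve_length) (use assms in auto)
  also have "(\<Sum>i<length ?ts - 1. ennreal (d (g (?ts ! i)) (g (?ts ! Suc i)))) =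
      ennreal (d x (g s)) + ennreal (d (g s) (g t)) + ennreal (d (g t) y)"
    using g by (simp add: numeral_3_eq_3)
  also have "\<dots> = ennreal (d x (g s) + d (g s) (g t) + d (g t) y)" by simp
  finally show ?thesis by (simp only: ennreal_le_iff[OF nonneg])
qed

text \<open>
  In the plane Stewart's inequality is an equality, and its right-hand side increases with the
  distances of the apex from the end points.
\<close>

lemma apex_comparison:
  fixes p' x' n' y' :: complex
  assumes "Metric_space X d" "stewart_on X d" and mem: "p \<in> X" "x \<in> X" "n \<in> X" "y \<in> X"
    and xny: "lies_between d x n y"
    and eu: "dist x' y' = d x y" "dist x' n' = d x n" "dist n' y' = d n y"
    and le: "d p x \<le> dist p' x'" "d p y \<le> dist p' y'"
  shows "d p n \<le> dist p' n'"
proof -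
  interpret Metric_space X d by fact
  show ?thesis
  proof (cases "d x y = 0")
    case True
    then have "d x n = 0" using xny nonneg[of x n] nonneg[of n y] unfolding lies_between_def by linarith
    then have "x = n" "x' = n'" using mem eu by auto
    then show ?thesis using le by simp
  next
    case False
    then have pos: "d x n + d n y > 0" using xny nonneg[of x y] by (simp add: lies_between_def less_le)
    have "(d p n)\<^sup>2 * (d x n + d n y) \<le>
        (d p x)\<^sup>2 * d n y + (d p y)\<^sup>2 * d x n - d x n * d n y * (d x n + d n y)"
      using assms(2) mem xny unfolding stewart_on_def stewart_ineq_def by blast
    also have "\<dots> \<le> (dist p' x')\<^sup>2 * d n y + (dist p' y')\<^sup>2 * d x n - d x n * d n y * (d x n + d n y)"
      using le by (intro diff_right_mono add_mono mult_right_mono power_mono) auto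
    also have "\<dots> = (dist p' n')\<^sup>2 * (d x n + d n y)"
      using euclidean_stewart[of x' y' n' p'] xny unfolding eu lies_between_def by simp
    finally have "(d p n)\<^sup>2 \<le> (dist p' n')\<^sup>2" using pos by simp
    then show ?thesis by (rule power2_le_imp_le) simp
  qed
qed

text \<open>
  For points \<open>p\<close> and \<open>q\<close> on sides with the common vertex \<open>x\<close>, first compare the distance of \<open>q\<close> from
  the other end \<open>y\<close> of the side of \<open>p\<close>, and then, with apex \<open>q\<close>, its distance from \<open>p\<close>. For points of one side
  both distances are differences of distances from an end point.
\<close>

lemma geodesic_triangle_thin:
  assumes M: "Metric_space X d" and st: "stewart_on X d"
    and tri: "geodesic_triangle X d a b c \<alpha> \<beta> \<gamma>"
  shows "thin_triangle d a b c \<alpha> \<beta> \<gamma>"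
proof -
  interpret Metric_space X d by fact
  have geo: "geodesic X d \<alpha> a b" "geodesic X d \<beta> b c" "geodesic X d \<gamma> c a"
    using tri by (auto simp: geodesic_triangle_def)
  have abc: "a \<in> X" "b \<in> X" "c \<in> X"
    using geodesic_mem[OF M geo(1), of 0] geodesic_mem[OF M geo(2), of 0] geodesic_mem[OF M geo(3), of 0] geo
    by (auto simp: geodesic_def)
  define on_side where "on_side x y x' y' p p' \<longleftrightarrow>
      p \<in> X \<and> lies_between d x p y \<and> dist x' p' = d x p \<and> dist p' y' = d p y" for x y x' y' p and p' :: complex
  have on_sideI: "on_side x y x' y' p p'"
    if g: "geodesic X d g x y" and on: "comparison_on_side d g x y x' y' p p'" for g x y x' y' p p'
  proof -
    obtain t where t: "t \<in> {0..1}" "p = g t" using on by (auto simp: comparison_on_side_def)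
    have "p \<in> X" using geodesic_mem[OF M g t(1)] t(2) by simp
    moreover have "x \<in> X" "y \<in> X"
      using geodesic_mem[OF M g, of 0] geodesic_mem[OF M g, of 1] g by (auto simp: geodesic_def)
    moreover have "d x p + d p y \<le> d x y"
      using geodesic_subdivision[OF M g, of t t] t \<open>p \<in> X\<close> by simp
    ultimately have "lies_between d x p y" using triangle[of x p y] by (simp add: lies_between_def)
    then show ?thesis
      using on \<open>p \<in> X\<close> commute[of y p] unfolding on_side_def comparison_on_side_def
      by (simp add: dist_commute)
  qed
  have on_side_swap: "on_side y x y' x' p p'" if "on_side x y x' y' p p'" for x y x' y' p p'
    using that commute[of x y] commute[of x p] commute[of p y]
    unfolding on_side_def lies_between_def by (simp add: dist_commute)
  have same: "d p q \<le> dist p' q'"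
    if g: "geodesic X d g x y" and xy: "dist x' y' = d x y"
      and p: "comparison_on_side d g x y x' y' p p'" and q: "comparison_on_side d g x y x' y' q q'"
    for g x y x' y' p q p' q'
  proof -
    have le: "d p q \<le> dist p' q'"
      if p: "comparison_on_side d g x y x' y' p p'" and q: "comparison_on_side d g x y x' y' q q'"
        and st: "0 \<le> s" "s \<le> t" "t \<le> 1" "p = g s" "q = g t" for p q p' q' s t
    proof -
      have "d x p + d p q + d q y \<le> d x y" using geodesic_subdivision[OF M g st(1-3)] st by simp
      moreover have "dist x' y' \<le> dist x' p' + dist p' q' + dist q' y'"
        using dist_triangle[of x' y' p'] dist_triangle[of p' y' q'] by linarith
      moreover have "dist x' p' = d x p" "dist q' y' = d q y"
        using p q commute[of y q] by (auto simp: comparison_on_side_def dist_commute)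
      ultimately show ?thesis using xy by linarith
    qed
    obtain s t where st: "s \<in> {0..1}" "t \<in> {0..1}" "p = g s" "q = g t"
      using p q by (auto simp: comparison_on_side_def)
    show ?thesis
    proof (cases "s \<le> t")
      case True
      then show ?thesis using le[OF p q, of s t] st by auto
    next
      case False
      then show ?thesis using le[OF q p, of t s] st commute[of p q] by (auto simp: dist_commute)
    qed
  qed
  have adjacent: "d p q \<le> dist p' q'"
    if mem: "x \<in> X" "y \<in> X" "z \<in> X" and eu: "dist x' y' = d x y" "dist x' z' = d x z" "dist y' z' = d y z"
      and p: "on_side x y x' y' p p'" and q: "on_side x z x' z' q q'" for x y z x' y' z' p q p' q'
  proof -
    have "d y q \<le> dist y' q'"
      using apex_comparison[OF M st mem(2,1) _ mem(3), of q x' z' q' y'] q eu commute[of y x]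
      unfolding on_side_def by (simp add: dist_commute)
    then have "d q p \<le> dist q' p'"
      using apex_comparison[OF M st _ mem(1) _ mem(2), of q p x' y' p' q'] p q eu(1) commute[of q x] commute[of q y]
      unfolding on_side_def by (simp add: dist_commute)
    then show ?thesis using commute[of q p] by (simp add: dist_commute)
  qed
  show ?thesis
    unfolding thin_triangle_def Let_def
  proof (intro allI impI)
    fix a' b' c' p p' q q'
    assume "comparison_triangle d a b c a' b' c'"
    then have eu: "dist a' b' = d a b" "dist b' c' = d b c" "dist c' a' = d c a"
      by (auto simp: comparison_triangle_def)
    then have eu': "dist b' a' = d b a" "dist c' b' = d c b" "dist a' c' = d a c"
      using commute by (auto simp: dist_commute)
    assume p: "comparison_on_side d \<alpha> a b a' b' p p' \<or> comparison_on_side d \<beta> b c b' c' p p' \<or>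
        comparison_on_side d \<gamma> c a c' a' p p'"
      and q: "comparison_on_side d \<alpha> a b a' b' q q' \<or> comparison_on_side d \<beta> b c b' c' q q' \<or>
        comparison_on_side d \<gamma> c a c' a' q q'"
    from p q show "d p q \<le> dist p' q'"
    proof (elim disjE)
      assume "comparison_on_side d \<alpha> a b a' b' p p'" "comparison_on_side d \<alpha> a b a' b' q q'"
      then show ?thesis by (rule same[OF geo(1) eu(1)])
    next
      assume "comparison_on_side d \<beta> b c b' c' p p'" "comparison_on_side d \<beta> b c b' c' q q'"
      then show ?thesis by (rule same[OF geo(2) eu(2)])
    next
      assume "comparison_on_side d \<gamma> c a c' a' p p'" "comparison_on_side d \<gamma> c a c' a' q q'"
      then show ?thesis by (rule same[OF geo(3) eu(3)])
    next
      assume "comparison_on_side d \<alpha> a b a' b' p p'" "comparison_on_side d \<beta> b c b' c' q q'"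
      then show ?thesis
        using adjacent[OF abc(2,1,3) eu'(1) eu(2) eu'(3)] on_sideI geo on_side_swap by blast
    next
      assume "comparison_on_side d \<alpha> a b a' b' p p'" "comparison_on_side d \<gamma> c a c' a' q q'"
      then show ?thesis
        using adjacent[OF abc(1,2,3) eu(1) eu'(3) eu(2)] on_sideI geo on_side_swap by blast
    next
      assume "comparison_on_side d \<beta> b c b' c' p p'" "comparison_on_side d \<alpha> a b a' b' q q'"
      then show ?thesis
        using adjacent[OF abc(2,3,1) eu(2) eu'(1) eu(3)] on_sideI geo on_side_swap by blast
    next
      assume "comparison_on_side d \<beta> b c b' c' p p'" "comparison_on_side d \<gamma> c a c' a' q q'"
      then show ?thesis
        using adjacent[OF abc(3,2,1) eu'(2) eu(3) eu'(1)] on_sideI geo on_side_swap by blast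
    next
      assume "comparison_on_side d \<gamma> c a c' a' p p'" "comparison_on_side d \<alpha> a b a' b' q q'"
      then show ?thesis
        using adjacent[OF abc(1,3,2) eu'(3) eu(1) eu'(2)] on_sideI geo on_side_swap by blast
    next
      assume "comparison_on_side d \<gamma> c a c' a' p p'" "comparison_on_side d \<beta> b c b' c' q q'"
      then show ?thesis
        using adjacent[OF abc(3,1,2) eu(3) eu'(2) eu(1)] on_sideI geo on_side_swap by blast
    qed
  qed
qed

context outer_approximation
begin

text \<open>
  The inequality holds at the limit point \<open>m\<close> with the same ratio as \<open>n\<close>. With apex \<open>n\<close> it says
  that \<open>m = n\<close>.
\<close>

lemma stewart_on_lipdist:
  assumes XJ: "X \<subseteq> J" and con: "\<And>x y. \<lbrakk>x \<in> X; y \<in> X\<rbrakk> \<Longrightarrow> \<exists>L. reach J x y L"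
  shows "stewart_on X (lipdist J)"
  unfolding stewart_on_def
proof (intro ballI impI)
  let ?d = "lipdist J"
  interpret Metric_space X ?d by (rule Metric_space_lipdist[OF assms])
  fix p x n y assume mem: "p \<in> X" "x \<in> X" "n \<in> X" "y \<in> X" and bet: "lies_between ?d x n y"
  have r: "\<exists>L. reach J u v L" if "u \<in> {p, x, n, y}" "v \<in> {p, x, n, y}" for u v
    using con that mem by blast
  show "stewart_ineq ?d p x n y"
  proof (cases "?d x y = 0")
    case True
    then have "?d x n = 0" using bet nonneg[of x n] nonneg[of n y] unfolding lies_between_def by linarith
    then have "x = y" "x = n" using True mem by auto
    then show ?thesis using mem by (simp add: stewart_ineq_def)
  next
    case False
    define D t where "D = ?d x y" and "t = ?d x n / D"
    have "D > 0" using False nonneg[of x y] unfolding D_def by linarith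
    have t: "?d x n = t * D" "?d n y = (1 - t) * D"
      using bet \<open>D > 0\<close> by (auto simp: t_def D_def lies_between_def field_simps)
    have t01: "0 \<le> t" "t \<le> 1"
      using bet \<open>D > 0\<close> nonneg[of x n] nonneg[of n y] by (auto simp: t_def D_def lies_between_def)
    obtain L0 where "reach J x y L0" using con mem by blast
    then obtain m where m: "reach J x m (t * D)"
      "\<And>q L1 L2. reach J q x L1 \<Longrightarrow> reach J q y L2 \<Longrightarrow>
         (?d q m)\<^sup>2 \<le> (1 - t) * (?d q x)\<^sup>2 + t * (?d q y)\<^sup>2 - t * (1 - t) * D\<^sup>2"
      using ratio_point_limit[OF _ t01] unfolding D_def by blast
    have mx: "(?d q m)\<^sup>2 \<le> (1 - t) * (?d q x)\<^sup>2 + t * (?d q y)\<^sup>2 - t * (1 - t) * D\<^sup>2"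
      if "q \<in> X" for q
    proof -
      obtain L1 L2 where "reach J q x L1" "reach J q y L2" using con mem \<open>q \<in> X\<close> by blast
      then show ?thesis by (rule m(2))
    qed
    have "(?d n m)\<^sup>2 \<le> 0"
      using mx[OF mem(3)] unfolding commute[of n x] t by (simp add: algebra_simps power2_eq_square)
    then have nm0: "?d n m = 0" by simp
    obtain L where "reach J n x L" using con mem by blast
    then have "reach J n m (L + t * D)" using m(1) reach_trans by blast
    then have "n = m" using dist_le_lipdist nm0 by fastforce
    then have "(?d p n)\<^sup>2 \<le> (1 - t) * (?d p x)\<^sup>2 + t * (?d p y)\<^sup>2 - t * (1 - t) * D\<^sup>2"
      using mx[OF mem(1)] by simp
    then have "(?d p n)\<^sup>2 * D \<le> ((1 - t) * (?d p x)\<^sup>2 + t * (?d p y)\<^sup>2 - t * (1 - t) * D\<^sup>2) * D"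
      using \<open>D > 0\<close> by (intro mult_right_mono) auto
    then show ?thesis
      unfolding stewart_ineq_def t by (simp add: algebra_simps power2_eq_square)
  qed
qed

text \<open>
  The set \<open>X\<close> is a class of mutually reachable points. Limits of curves that join members of a
  Cauchy sequence stay in the class, which gives completeness.
\<close>

theorem CAT0_space_lipdist:
  assumes XJ: "X \<subseteq> J" and con: "\<And>x y. \<lbrakk>x \<in> X; y \<in> X\<rbrakk> \<Longrightarrow> \<exists>L. reach J x y L"
    and sat: "\<And>x y L. \<lbrakk>x \<in> X; reach J x y L\<rbrakk> \<Longrightarrow> y \<in> X"
  shows "CAT0_space X (lipdist J)"
proof -
  let ?d = "lipdist J"
  have M: "Metric_space X ?d" by (rule Metric_space_lipdist[OF XJ con])
  interpret Metric_space X ?d by (rule M)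
  have dle: "dist x y \<le> ?d x y" if "x \<in> X" "y \<in> X" for x y
    using con[OF that] dist_le_lipdist by blast
  have "mcomplete"
    unfolding mcomplete_def
  proof (intro allI impI)
    fix \<sigma> assume "MCauchy \<sigma>"
    then have \<sigma>X: "\<sigma> n \<in> X" and cau: "\<And>e. e > 0 \<Longrightarrow> \<exists>N. \<forall>n n'. N \<le> n \<longrightarrow> N \<le> n' \<longrightarrow> ?d (\<sigma> n) (\<sigma> n') < e" for n
      unfolding MCauchy_def by blast+
    have "Cauchy \<sigma>"
    proof (rule metric_CauchyI)
      fix e :: real assume "e > 0"
      then obtain N where N: "\<And>n n'. N \<le> n \<Longrightarrow> N \<le> n' \<Longrightarrow> ?d (\<sigma> n) (\<sigma> n') < e" using cau by blast
      have "dist (\<sigma> m) (\<sigma> n) < e" if "m \<ge> N" "n \<ge> N" for m n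
        using N[OF that] dle[OF \<sigma>X \<sigma>X, of m n] by linarith
      then show "\<exists>N. \<forall>m\<ge>N. \<forall>n\<ge>N. dist (\<sigma> m) (\<sigma> n) < e" by blast
    qed
    then obtain z where z: "\<sigma> \<longlonglongrightarrow> z" using Cauchy_convergent convergent_def by blast
    have near: "reach J (\<sigma> n) z e" if N: "\<And>n n'. N \<le> n \<Longrightarrow> N \<le> n' \<Longrightarrow> ?d (\<sigma> n) (\<sigma> n') < e" and "N \<le> n" for e N n
    proof (rule reach_limit_J[OF _ tendsto_const _ tendsto_const])
      show "reach J (\<sigma> n) (\<sigma> (k + N)) e" for k
      proof (rule reach_mono)
        show "reach J (\<sigma> n) (\<sigma> (k + N)) (?d (\<sigma> n) (\<sigma> (k + N)))"
          using con[OF \<sigma>X \<sigma>X] reach_lipdist_attained by blast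
        show "?d (\<sigma> n) (\<sigma> (k + N)) \<le> e" using N[OF \<open>N \<le> n\<close>, of "k + N"] by simp
      qed
      show "(\<lambda>k. \<sigma> (k + N)) \<longlonglongrightarrow> z" using z by (rule LIMSEQ_ignore_initial_segment)
    qed
    have "z \<in> X"
    proof -
      obtain N where "\<And>n n'. N \<le> n \<Longrightarrow> N \<le> n' \<Longrightarrow> ?d (\<sigma> n) (\<sigma> n') < 1" using cau[of 1] by auto
      then have "reach J (\<sigma> N) z 1" using near by blast
      then show ?thesis using sat \<sigma>X by blast
    qed
    moreover have "\<exists>N. \<forall>n\<ge>N. \<sigma> n \<in> X \<and> ?d (\<sigma> n) z < e" if "e > 0" for e
    proof -
      obtain N where N: "\<And>n n'. N \<le> n \<Longrightarrow> N \<le> n' \<Longrightarrow> ?d (\<sigma> n) (\<sigma> n') < e / 2"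
        using cau[of "e / 2"] \<open>e > 0\<close> by auto
      have "?d (\<sigma> n) z < e" if "N \<le> n" for n
        using lipdist_le[OF near[OF N that]] \<open>e > 0\<close> by linarith
      then show ?thesis using \<sigma>X by blast
    qed
    ultimately have "limitin mtopology \<sigma> z sequentially" unfolding limit_metric_sequentially by blast
    then show "\<exists>z. limitin mtopology \<sigma> z sequentially" by blast
  qed
  moreover have "\<exists>g. geodesic X ?d g x y" if xy: "x \<in> X" "y \<in> X" for x y
  proof -
    define D where "D = ?d x y"
    have "reach J x y D" unfolding D_def using con[OF xy] reach_lipdist_attained by blast
    then obtain g where g: "1-lipschitz_on {0..D} g" "g ` {0..D} \<subseteq> J" "g 0 = x" "g D = y" "0 \<le> D"
      unfolding reach_def by blast
    have r: "reach J (g s) (g t) (t - s)" if "0 \<le> s" "s \<le> t" "t \<le> D" for s t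
      by (rule reachI[OF lipschitz_on_subset[OF g(1)]]) (use g(2) that in \<open>auto simp: image_subset_iff\<close>)
    let ?h = "\<lambda>t. g (D * t)"
    have rh: "reach J (?h s) (?h t) (D * (t - s))" if "0 \<le> s" "s \<le> t" "t \<le> 1" for s t
      using r[of "D * s" "D * t"] that g(5) mult_left_mono[of s t D] mult_left_le[of t D]
      by (simp add: right_diff_distrib)
    have hX: "?h t \<in> X" if "t \<in> {0..1}" for t
      using sat[OF xy(1)] rh[of 0 t] that g(3) by auto
    have lip: "?d (?h s) (?h t) \<le> D * \<bar>t - s\<bar>" if "s \<in> {0..1}" "t \<in> {0..1}" for s t
    proof (cases "s \<le> t")
      case True
      then show ?thesis using lipdist_le[OF rh[of s t]] that by simp
    next
      case False
      then show ?thesis using lipdist_le[OF rh[of t s]] that commute[of "?h s" "?h t"] by simp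
    qed
    have "geodesic X ?d ?h x y"
      unfolding geodesic_def
    proof (intro conjI)
      show "continuous_map (top_of_set {0..1}) mtopology ?h"
        unfolding continuous_map_to_metric
      proof (intro ballI allI impI)
        fix t e :: real assume t: "t \<in> topspace (top_of_set {0..1})" and e: "e > 0"
        let ?U = "{0..1} \<inter> ball t (e / (D + 1))"
        have D1: "D + 1 > 0" using g(5) by simp
        have "?h u \<in> mball (?h t) e" if u: "u \<in> ?U" for u
        proof -
          have "?d (?h t) (?h u) \<le> D * \<bar>u - t\<bar>" using lip[of t u] t u by auto
          also have "\<dots> \<le> (D + 1) * \<bar>u - t\<bar>" by (intro mult_right_mono) auto
          also have "\<dots> < (D + 1) * (e / (D + 1))"
            using u D1 by (intro mult_strict_left_mono) (auto simp: dist_real_def abs_minus_commute)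
          also have "\<dots> = e" using D1 by simp
          finally show ?thesis using hX[of t] hX[of u] t u by (auto simp: in_mball)
        qed
        moreover have "openin (top_of_set {0..1}) ?U" by (intro openin_open_Int) auto
        moreover have "t \<in> ?U" using t e D1 by auto
        ultimately show "\<exists>U. openin (top_of_set {0..1}) U \<and> t \<in> U \<and> (\<forall>u\<in>U. ?h u \<in> mball (?h t) e)"
          by blast
      qed
      show "curve_length ?d ?h = ennreal (?d x y)"
      proof (rule antisym)
        show "curve_length ?d ?h \<le> ennreal (?d x y)"
          unfolding D_def[symmetric] by (rule curve_length_lipschitz_le[OF g(5)])
             (rule order_trans[OF lip], auto)
        have "(\<Sum>i<length [0, 1::real] - 1. ennreal (?d (?h ([0, 1] ! i)) (?h ([0, 1] ! Suc i)))) \<le> curve_length ?d ?h"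
          by (rule sum_le_curve_length) auto
        then show "ennreal (?d x y) \<le> curve_length ?d ?h" using g(3,4) by simp
      qed
    qed (use g in auto)
    then show ?thesis by blast
  qed
  moreover have "thin_triangle ?d a b c \<alpha> \<beta> \<gamma>" if "geodesic_triangle X ?d a b c \<alpha> \<beta> \<gamma>" for a b c \<alpha> \<beta> \<gamma>
    using geodesic_triangle_thin[OF M stewart_on_lipdist[OF XJ con] that] by blast
  ultimately show ?thesis unfolding CAT0_space_def using M by blast
qed

end

section \<open>Jordan domains\<close>

text \<open>
  The complement of \<open>J\<close> is connected and unbounded and thus lies outside \<open>C\<close>. The remaining points \<open>J - C\<close>
  form a connected set; if it met the outside of \<open>C\<close>, nothing would be left for the inside.
\<close>

lemma jordan_domain_props:
  assumes "jordan_domain J C"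
  shows "compact J" "connected J" "connected (- J)" "J = C \<union> inside C" "inside C \<noteq> {}"
    "open (inside C)" "connected (inside C)"
proof -
  obtain h k where hk: "homeomorphism (cball (0::complex) 1) J h k" and C: "C = h ` sphere 0 1"
    using assms unfolding jordan_domain_def by blast
  have hc: "continuous_on (cball 0 1) h" and hJ: "h ` cball 0 1 = J" and kh: "\<And>z. z \<in> cball 0 1 \<Longrightarrow> k (h z) = z"
    using hk by (auto simp: homeomorphism_def)
  have inj: "inj_on h (cball 0 1)" using kh by (metis inj_on_inverseI)
  show "compact J" using compact_continuous_image[OF hc compact_cball] hJ by simp
  show "connected J" using connected_continuous_image[OF hc] hJ by simp
  have "J homeomorphic cball (0::complex) 1"
    using hk homeomorphic_def homeomorphic_sym by blast
  then show coJ: "connected (- J)"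
    by (rule connected_complement_homeomorphic_convex_compact) auto
  let ?c = "h \<circ> circlepath 0 1"
  have pic: "path_image ?c = C"
    unfolding C path_image_def image_comp[symmetric]
    using path_image_circlepath[of 0 1] by (simp add: path_image_def)
  have pc: "path_image (circlepath (0::complex) 1) \<subseteq> cball 0 1" by auto
  have "simple_path ?c"
    by (rule simple_path_continuous_image[OF _ continuous_on_subset[OF hc pc] inj_on_subset[OF inj pc]])
       (simp add: simple_path_circlepath)
  moreover have "pathfinish ?c = pathstart ?c" by (simp add: pathfinish_compose pathstart_compose)
  ultimately have jc: "inside C \<noteq> {}" "open (inside C)" "connected (inside C)"
    "open (outside C)" "connected (outside C)"
    using Jordan_inside_outside[of ?c] unfolding pic by auto
  then show "inside C \<noteq> {}" "open (inside C)" "connected (inside C)" by auto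
  have CJ: "C \<subseteq> J" unfolding C hJ[symmetric] by auto
  have "bounded C" using CJ \<open>compact J\<close> compact_imp_bounded bounded_subset by blast
  have "- J \<subseteq> outside C"
  proof
    fix z assume z: "z \<in> - J"
    have "\<not> bounded (- J)"
      using compact_imp_bounded[OF \<open>compact J\<close>] cobounded_imp_unbounded[of "- J"] by simp
    moreover have "- J \<subseteq> connected_component_set (- C) z"
      using z coJ CJ by (intro connected_component_maximal) auto
    ultimately have "\<not> bounded (connected_component_set (- C) z)" using bounded_subset by blast
    then show "z \<in> outside C" using z CJ by (auto simp: outside)
  qed
  then have 1: "inside C \<subseteq> J" using inside_Int_outside[of C] by blast
  have JC: "J - C = h ` ball 0 1"
  proof -
    have "cball (0::complex) 1 = ball 0 1 \<union> sphere 0 1" by auto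
    then have "J = h ` ball 0 1 \<union> C" using hJ C by (metis image_Un)
    moreover have "h ` ball 0 1 \<inter> C = {}" unfolding C
      using inj_on_image_Int[OF inj, of "ball 0 1" "sphere 0 1"] by auto
    ultimately show ?thesis by blast
  qed
  have "connected (J - C)"
    unfolding JC by (intro connected_continuous_image continuous_on_subset[OF hc]) auto
  have "J - C \<subseteq> inside C"
  proof (rule ccontr)
    assume "\<not> ?thesis"
    then obtain z where z: "z \<in> J" "z \<notin> C" "z \<in> outside C" using inside_Un_outside[of C] by blast
    have "J - C \<subseteq> outside C"
    proof
      fix w assume w: "w \<in> J - C"
      have "connected_component (- C) z w"
        unfolding connected_component_def using \<open>connected (J - C)\<close> w z by (intro exI[of _ "J - C"]) auto
      then show "w \<in> outside C" using z(3) outside_same_component by blast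
    qed
    then show False using 1 jc(1) inside_Int_outside[of C] inside_no_overlap[of C] by blast
  qed
  then show "J = C \<union> inside C" using 1 CJ by blast
qed

lemma reach_open_connected:
  assumes "open U" "connected U" "x \<in> U" "y \<in> U" shows "\<exists>L. reach U x y L"
proof (rule connected_equivalence_relation[OF assms(2-4)])
  fix a assume "a \<in> U"
  then obtain e where e: "e > 0" "ball a e \<subseteq> U" using assms(1) open_contains_ball by blast
  have "\<exists>L. reach U a b L" if "b \<in> ball a e" for b
  proof -
    have "closed_segment a b \<subseteq> ball a e" using that e(1) by (intro closed_segment_subset) auto
    then show ?thesis using reach_segment e(2) by blast
  qed
  moreover have "openin (top_of_set U) (ball a e)" using e(2) by (simp add: openin_open_eq assms(1))
  ultimately show "\<exists>T. openin (top_of_set U) T \<and> a \<in> T \<and> (\<forall>x\<in>T. \<exists>L. reach U a x L)"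
    using e(1) by (intro exI[of _ "ball a e"]) auto
qed (use reach_commute reach_trans in blast)+

theorem theorem2p1:
  fixes J C :: "complex set"
  assumes "jordan_domain J C"
  shows "CAT0_space (finite_distance_points J C) (length_metric J)"
proof -
  note J = jordan_domain_props[OF assms]
  let ?X = "finite_distance_points J C"
  have "J \<noteq> {}" using J(4,5) by blast
  then obtain P where "outer_approximation J P"
    using exists_outer_approximation[OF J(1,2) _ J(3)] by blast
  then interpret outer_approximation J P .
  have X: "?X = {p \<in> J. \<exists>q\<in>inside C. \<exists>L. reach J p q L}"
  proof (intro equalityI subsetI)
    fix p assume "p \<in> ?X"
    then consider "p \<in> inside C"
      | q g where "p \<in> C" "q \<in> inside C" "g \<in> curves_in J p q" "curve_length dist g < \<infinity>"
      unfolding finite_distance_points_def by blast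
    then show "p \<in> {p \<in> J. \<exists>q\<in>inside C. \<exists>L. reach J p q L}"
    proof cases
      case 1
      then have "p \<in> J" using J(4) by blast
      then have "reach J p p 0" by (simp add: reach_const)
      then show ?thesis using 1 \<open>p \<in> J\<close> by blast
    next
      case 2
      from 2(4) obtain r where "0 \<le> r" "curve_length dist g = ennreal r"
        by (cases "curve_length dist g") auto
      then have "reach J p q r" using curve_imp_reach[OF 2(3)] by simp
      then show ?thesis using 2 reach_mem by blast
    qed
  next
    fix p assume "p \<in> {p \<in> J. \<exists>q\<in>inside C. \<exists>L. reach J p q L}"
    then obtain q L where p: "p \<in> J" "q \<in> inside C" "reach J p q L" by blast
    then obtain g where "g \<in> curves_in J p q" "curve_length dist g \<le> ennreal L"
      using reach_imp_curve by blast
    then have "g \<in> curves_in J p q" "curve_length dist g < \<infinity>"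
      by (auto intro: le_less_trans)
    then show "p \<in> ?X" using p J(4) unfolding finite_distance_points_def by blast
  qed
  have con: "\<exists>L. reach J x y L" if xy: "x \<in> ?X" "y \<in> ?X" for x y
  proof -
    obtain u v L M where uv: "u \<in> inside C" "v \<in> inside C" "reach J x u L" "reach J y v M"
      using xy unfolding X by blast
    obtain K where "reach (inside C) u v K" using reach_open_connected[OF J(6,7) uv(1,2)] by blast
    then have "reach J u v K" using reach_subset J(4) by blast
    then show ?thesis using uv(3,4) reach_trans reach_commute by blast
  qed
  have "CAT0_space ?X (lipdist J)"
  proof (rule CAT0_space_lipdist[OF _ con])
    show "?X \<subseteq> J" unfolding X by blast
    fix x y L assume "x \<in> ?X" "reach J x y L"
    then show "y \<in> ?X" unfolding X using reach_trans reach_commute reach_mem(2) by blast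
  qed
  then show ?thesis by (simp only: length_metric_eq_lipdist)
qed

end
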